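(* Let $k$ be a field, let $q\in k^\times$, and let $m,n$ be positive integers. Write $\mathcal{O}_q(k^m)=k[y_1,\dots,y_m]$ and $\mathcal{O}_q(k^n)=k[z_1,\dots,z_n]$ for the coordinate rings of quantum affine spaces. Let $\theta:\mathcal{O}_q(M_{m,n}(k))\to \mathcal{O}_q(k^m)\otimes\mathcal{O}_q(k^n)$ be the $k$-algebra homomorphism with $\theta(X_{ij})=y_i\otimes z_j$ for all $i,j$, and let $$\gamma:\mathcal{O}_q(k^m)\otimes\mathcal{O}_q(k^n)\to k[x,x^{-1}]\otimes\mathcal{O}_q(k^m)\otimes\mathcal{O}_q(k^n)$$ be the $k$-algebra homomorphism with $\gamma(y_i\otimes 1)=x^{-1}\otimes y_i\otimes 1$ and $\gamma(1\otimes z_j)=x\otimes 1\otimes z_j$ for all $i,j$. Then the set of coinvariants of $\gamma$, namely $\{w\in \mathcal{O}_q(k^m)\otimes\mathcal{O}_q(k^n) : \gamma(w)=1\otimes w\}$, is exactly the image of $\mathcal{O}_q(M_{m,n}(k))$ under $\theta$.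
   Context: All tensor products are over $k$, with the usual algebra structure. $k[x,x^{-1}]$ is the commutative Laurent polynomial ring in one variable. The coordinate ring of quantum $m\times n$ matrices $\mathcal{O}_q(M_{m,n}(k))$ is the $k$-algebra generated by $X_{ij}$ ($1\le i\le m$, $1\le j\le n$) subject to the relations: $X_{ij}X_{lj}=qX_{lj}X_{ij}$ when $i<l$; $X_{ij}X_{is}=qX_{is}X_{ij}$ when $j<s$; $X_{is}X_{lj}=X_{lj}X_{is}$ when $i<l$ and $j<s$; $X_{ij}X_{ls}-X_{ls}X_{ij}=(q-q^{-1})X_{is}X_{lj}$ when $i<l$ and $j<s$. The coordinate ring of quantum affine $n$-space $\mathcal{O}_q(k^n)$ is the $k$-algebra on generators $z_1,\dots,z_n$ subject to the relations $z_iz_j=qz_jz_i$ for $1\le i<j\le n$; similarly $\mathcal{O}_q(k^m)$ on generators $y_1,\dots,y_m$. The homomorphisms $\theta$ and $\gamma$ are well defined on these presentations. *)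

theory Defs
  imports "HOL-Algebra.Module" "HOL-Algebra.QuotRing" "HOL-Algebra.Elementary_Groups"
begin

text \<open>
  A \<open>k\<close>-algebra is represented by a HOL-Algebra ring record with a scalar multiplication, i.e.\ by
  the library record type of modules. It is not assumed to be commutative.
\<close>

definition alg_hom ::
    "('k, 'e) ring_scheme \<Rightarrow> ('k, 'a, 'c) module_scheme \<Rightarrow> ('k, 'b, 'd) module_scheme \<Rightarrow> ('a \<Rightarrow> 'b) set"
  where "alg_hom K A B =
    {h \<in> ring_hom A B. \<forall>c\<in>carrier K. \<forall>a\<in>carrier A. h (c \<odot>\<^bsub>A\<^esub> a) = c \<odot>\<^bsub>B\<^esub> h a}"

definition quot_algebra :: "('k, 'a, 'c) module_scheme \<Rightarrow> 'a set \<Rightarrow> ('k, 'a set) module"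
  where "quot_algebra A I =
    \<lparr>carrier = carrier (A Quot I), mult = mult (A Quot I), one = one (A Quot I),
     zero = zero (A Quot I), add = add (A Quot I),
     smult = (\<lambda>c C. \<Union>a\<in>C. I +>\<^bsub>A\<^esub> (c \<odot>\<^bsub>A\<^esub> a))\<rparr>"

text \<open>A set of relations is given as a set of pairs \<open>(l, r)\<close>, each standing for \<open>l = r\<close>.\<close>

definition rel_ideal :: "('k, 'a, 'c) module_scheme \<Rightarrow> ('a \<times> 'a) set \<Rightarrow> 'a set"
  where "rel_ideal A R = Idl\<^bsub>A\<^esub> ((\<lambda>(l, r). l \<ominus>\<^bsub>A\<^esub> r) ` R)"

definition quot_rels :: "('k, 'a, 'c) module_scheme \<Rightarrow> ('a \<times> 'a) set \<Rightarrow> ('k, 'a set) module"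
  where "quot_rels A R = quot_algebra A (rel_ideal A R)"

definition quot_class :: "('k, 'a, 'c) module_scheme \<Rightarrow> ('a \<times> 'a) set \<Rightarrow> 'a \<Rightarrow> 'a set"
  where "quot_class A R a = rel_ideal A R +>\<^bsub>A\<^esub> a"


text \<open>
  The monoid algebra \<open>K[M]\<close>: finitely supported functions from the carrier of \<open>M\<close> to \<open>K\<close>
  (extended by zero outside the carrier) with the convolution product.
\<close>

definition monoid_algebra ::
    "('k, 'e) ring_scheme \<Rightarrow> ('a, 'c) monoid_scheme \<Rightarrow> ('k, 'a \<Rightarrow> 'k) module"
  where "monoid_algebra K M =
    \<lparr>carrier = {f. (\<forall>x. f x \<in> carrier K) \<and> finite {x. f x \<noteq> \<zero>\<^bsub>K\<^esub>} \<and> {x. f x \<noteq> \<zero>\<^bsub>K\<^esub>} \<subseteq> carrier M},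
     mult = (\<lambda>f g x. finsum K (\<lambda>(a, b). f a \<otimes>\<^bsub>K\<^esub> g b)
               {(a, b). f a \<noteq> \<zero>\<^bsub>K\<^esub> \<and> g b \<noteq> \<zero>\<^bsub>K\<^esub> \<and> a \<otimes>\<^bsub>M\<^esub> b = x}),
     one = (\<lambda>x. if x = \<one>\<^bsub>M\<^esub> then \<one>\<^bsub>K\<^esub> else \<zero>\<^bsub>K\<^esub>),
     zero = (\<lambda>x. \<zero>\<^bsub>K\<^esub>),
     add = (\<lambda>f g x. f x \<oplus>\<^bsub>K\<^esub> g x),
     smult = (\<lambda>c f x. c \<otimes>\<^bsub>K\<^esub> f x)\<rparr>"

definition basis_elem :: "('k, 'e) ring_scheme \<Rightarrow> 'a \<Rightarrow> 'a \<Rightarrow> 'k"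
  where "basis_elem K a = (\<lambda>x. if x = a then \<one>\<^bsub>K\<^esub> else \<zero>\<^bsub>K\<^esub>)"


definition word_monoid :: "'s set \<Rightarrow> 's list monoid"
  where "word_monoid S = \<lparr>carrier = lists S, mult = (@), one = []\<rparr>"

definition free_algebra :: "('k, 'e) ring_scheme \<Rightarrow> 's set \<Rightarrow> ('k, 's list \<Rightarrow> 'k) module"
  where "free_algebra K S = monoid_algebra K (word_monoid S)"

definition free_gen :: "('k, 'e) ring_scheme \<Rightarrow> 's \<Rightarrow> 's list \<Rightarrow> 'k"
  where "free_gen K s = basis_elem K [s]"


text \<open>\<open>k[x, x\<^sup>-\<^sup>1]\<close> is the group algebra of the integers, the integer \<open>d\<close> corresponding to \<open>x\<^sup>d\<close>.\<close>

definition laurent_algebra :: "('k, 'e) ring_scheme \<Rightarrow> ('k, int \<Rightarrow> 'k) module"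
  where "laurent_algebra K = monoid_algebra K integer_group"

definition laurent_x :: "('k, 'e) ring_scheme \<Rightarrow> int \<Rightarrow> 'k"
  where "laurent_x K = basis_elem K 1"

definition laurent_x_inv :: "('k, 'e) ring_scheme \<Rightarrow> int \<Rightarrow> 'k"
  where "laurent_x_inv K = basis_elem K (- 1)"


text \<open>
  The tensor product of algebras: the vector space with basis all pairs \<open>(a, b)\<close>, modulo
  bilinearity, with multiplication \<open>(a \<otimes> b)(a' \<otimes> b') = aa' \<otimes> bb'\<close>. The vector space with that
  multiplication is the monoid algebra of the direct product of the multiplicative monoids of
  \<open>A\<close> and \<open>B\<close>; multiplying a bilinearity relation by a pair gives a bilinearity relation
  again, so the ideal generated by these relations is just their linear span.
\<close>

definition bilinear_rels ::
    "('k, 'e) ring_scheme \<Rightarrow> ('k, 'a, 'c) module_scheme \<Rightarrow> ('k, 'b, 'd) module_scheme \<Rightarrow>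
      (('a \<times> 'b \<Rightarrow> 'k) \<times> ('a \<times> 'b \<Rightarrow> 'k)) set"
  where "bilinear_rels K A B =
    (let F = monoid_algebra K (A \<times>\<times> B); p = (\<lambda>a b. basis_elem K (a, b)) in
      {(p (a \<oplus>\<^bsub>A\<^esub> a') b, p a b \<oplus>\<^bsub>F\<^esub> p a' b) | a a' b.
          a \<in> carrier A \<and> a' \<in> carrier A \<and> b \<in> carrier B} \<union>
      {(p a (b \<oplus>\<^bsub>B\<^esub> b'), p a b \<oplus>\<^bsub>F\<^esub> p a b') | a b b'.
          a \<in> carrier A \<and> b \<in> carrier B \<and> b' \<in> carrier B} \<union>
      {(p (c \<odot>\<^bsub>A\<^esub> a) b, c \<odot>\<^bsub>F\<^esub> p a b) | c a b.
          c \<in> carrier K \<and> a \<in> carrier A \<and> b \<in> carrier B} \<union>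
      {(p a (c \<odot>\<^bsub>B\<^esub> b), c \<odot>\<^bsub>F\<^esub> p a b) | c a b.
          c \<in> carrier K \<and> a \<in> carrier A \<and> b \<in> carrier B})"

definition tensor_algebra ::
    "('k, 'e) ring_scheme \<Rightarrow> ('k, 'a, 'c) module_scheme \<Rightarrow> ('k, 'b, 'd) module_scheme \<Rightarrow>
      ('k, ('a \<times> 'b \<Rightarrow> 'k) set) module"
  where "tensor_algebra K A B = quot_rels (monoid_algebra K (A \<times>\<times> B)) (bilinear_rels K A B)"

definition pure_tensor ::
    "('k, 'e) ring_scheme \<Rightarrow> ('k, 'a, 'c) module_scheme \<Rightarrow> ('k, 'b, 'd) module_scheme \<Rightarrow>
      'a \<Rightarrow> 'b \<Rightarrow> ('a \<times> 'b \<Rightarrow> 'k) set"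
  where "pure_tensor K A B a b =
    quot_class (monoid_algebra K (A \<times>\<times> B)) (bilinear_rels K A B) (basis_elem K (a, b))"


definition qaffine_rels ::
    "('k, 'e) ring_scheme \<Rightarrow> 'k \<Rightarrow> nat \<Rightarrow> ((nat list \<Rightarrow> 'k) \<times> (nat list \<Rightarrow> 'k)) set"
  where "qaffine_rels K q n =
    (let F = free_algebra K {1..n}; z = free_gen K in
      {(z i \<otimes>\<^bsub>F\<^esub> z j, q \<odot>\<^bsub>F\<^esub> (z j \<otimes>\<^bsub>F\<^esub> z i)) | i j. 1 \<le> i \<and> i < j \<and> j \<le> n})"

definition qaffine :: "('k, 'e) ring_scheme \<Rightarrow> 'k \<Rightarrow> nat \<Rightarrow> ('k, (nat list \<Rightarrow> 'k) set) module"
  where "qaffine K q n = quot_rels (free_algebra K {1..n}) (qaffine_rels K q n)"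

definition qaffine_gen :: "('k, 'e) ring_scheme \<Rightarrow> 'k \<Rightarrow> nat \<Rightarrow> nat \<Rightarrow> (nat list \<Rightarrow> 'k) set"
  where "qaffine_gen K q n i = quot_class (free_algebra K {1..n}) (qaffine_rels K q n) (free_gen K i)"


definition qmatrix_rels ::
    "('k, 'e) ring_scheme \<Rightarrow> 'k \<Rightarrow> nat \<Rightarrow> nat \<Rightarrow>
      (((nat \<times> nat) list \<Rightarrow> 'k) \<times> ((nat \<times> nat) list \<Rightarrow> 'k)) set"
  where "qmatrix_rels K q m n =
    (let F = free_algebra K ({1..m} \<times> {1..n}); X = (\<lambda>i j. free_gen K (i, j)) in
      {(X i j \<otimes>\<^bsub>F\<^esub> X l j, q \<odot>\<^bsub>F\<^esub> (X l j \<otimes>\<^bsub>F\<^esub> X i j)) | i l j.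
          i \<in> {1..m} \<and> l \<in> {1..m} \<and> j \<in> {1..n} \<and> i < l} \<union>
      {(X i j \<otimes>\<^bsub>F\<^esub> X i s, q \<odot>\<^bsub>F\<^esub> (X i s \<otimes>\<^bsub>F\<^esub> X i j)) | i j s.
          i \<in> {1..m} \<and> j \<in> {1..n} \<and> s \<in> {1..n} \<and> j < s} \<union>
      {(X i s \<otimes>\<^bsub>F\<^esub> X l j, X l j \<otimes>\<^bsub>F\<^esub> X i s) | i l j s.
          i \<in> {1..m} \<and> l \<in> {1..m} \<and> j \<in> {1..n} \<and> s \<in> {1..n} \<and> i < l \<and> j < s} \<union>
      {(X i j \<otimes>\<^bsub>F\<^esub> X l s \<ominus>\<^bsub>F\<^esub> X l s \<otimes>\<^bsub>F\<^esub> X i j,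
        (q \<ominus>\<^bsub>K\<^esub> inv\<^bsub>K\<^esub> q) \<odot>\<^bsub>F\<^esub> (X i s \<otimes>\<^bsub>F\<^esub> X l j)) | i l j s.
          i \<in> {1..m} \<and> l \<in> {1..m} \<and> j \<in> {1..n} \<and> s \<in> {1..n} \<and> i < l \<and> j < s})"

definition qmatrix ::
    "('k, 'e) ring_scheme \<Rightarrow> 'k \<Rightarrow> nat \<Rightarrow> nat \<Rightarrow> ('k, ((nat \<times> nat) list \<Rightarrow> 'k) set) module"
  where "qmatrix K q m n = quot_rels (free_algebra K ({1..m} \<times> {1..n})) (qmatrix_rels K q m n)"

definition qmatrix_gen ::
    "('k, 'e) ring_scheme \<Rightarrow> 'k \<Rightarrow> nat \<Rightarrow> nat \<Rightarrow> nat \<Rightarrow> nat \<Rightarrow> ((nat \<times> nat) list \<Rightarrow> 'k) set"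
  where "qmatrix_gen K q m n i j =
    quot_class (free_algebra K ({1..m} \<times> {1..n})) (qmatrix_rels K q m n) (free_gen K (i, j))"

end

theory Submission
  imports Defs
begin

text \<open>
  Words \<open>u\<close> in the \<open>y\<^sub>i\<close> and \<open>v\<close> in the \<open>z\<^sub>j\<close> give elements \<open>u \<otimes> v\<close> spanning the tensor product \<open>T\<close>
  of the two quantum affine spaces, and \<open>\<gamma>\<close> sends \<open>u \<otimes> v\<close> to \<open>x\<^bsup>|v| - |u|\<^esup> \<otimes> u \<otimes> v\<close>. The linear map
  \<open>\<pi> : k[x, x\<^sup>-\<^sup>1] \<otimes> T \<rightarrow> T\<close> with \<open>\<pi> (f \<otimes> w) = f\<^sub>0 w\<close>, where \<open>f\<^sub>0\<close> is the constant coefficient, satisfies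
  \<open>\<pi> (\<gamma> w) = w\<close> for every coinvariant \<open>w\<close>. On the other hand \<open>\<pi> \<circ> \<gamma>\<close> kills \<open>u \<otimes> v\<close> unless \<open>|u| = |v|\<close>,
  in which case \<open>u \<otimes> v\<close> is a product of elements \<open>y\<^sub>i \<otimes> z\<^sub>j = \<theta> X\<^sub>i\<^sub>j\<close>. So no basis of the quantum affine
  spaces is needed, only the universal property of the tensor product, which gives \<open>\<pi>\<close>.
\<close>

section \<open>Associative algebras, linear maps and monoid algebras\<close>

text \<open>The algebras here are noncommutative, so the compatibility of scalars with products must
  be required in each factor separately; neither law follows from the other without commuting
  \<open>a\<close> and \<open>b\<close>.\<close>

locale assoc_algebra = module K A + A: ring A for K (structure) and A (structure) +
  assumes smult_mult_l: "\<lbrakk>c \<in> carrier K; a \<in> carrier A; b \<in> carrier A\<rbrakk> \<Longrightarrow>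
      (c \<odot>\<^bsub>A\<^esub> a) \<otimes>\<^bsub>A\<^esub> b = c \<odot>\<^bsub>A\<^esub> (a \<otimes>\<^bsub>A\<^esub> b)"
    and smult_mult_r: "\<lbrakk>c \<in> carrier K; a \<in> carrier A; b \<in> carrier A\<rbrakk> \<Longrightarrow>
      a \<otimes>\<^bsub>A\<^esub> (c \<odot>\<^bsub>A\<^esub> b) = c \<odot>\<^bsub>A\<^esub> (a \<otimes>\<^bsub>A\<^esub> b)"

lemma assoc_algebraI:
  fixes K (structure) and A (structure)
  assumes "cring K" and "ring A"
    and "\<And>c x. \<lbrakk>c \<in> carrier K; x \<in> carrier A\<rbrakk> \<Longrightarrow> c \<odot>\<^bsub>A\<^esub> x \<in> carrier A"
    and "\<And>c d x. \<lbrakk>c \<in> carrier K; d \<in> carrier K; x \<in> carrier A\<rbrakk> \<Longrightarrow>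
      (c \<oplus> d) \<odot>\<^bsub>A\<^esub> x = (c \<odot>\<^bsub>A\<^esub> x) \<oplus>\<^bsub>A\<^esub> (d \<odot>\<^bsub>A\<^esub> x)"
    and "\<And>c x y. \<lbrakk>c \<in> carrier K; x \<in> carrier A; y \<in> carrier A\<rbrakk> \<Longrightarrow>
      c \<odot>\<^bsub>A\<^esub> (x \<oplus>\<^bsub>A\<^esub> y) = (c \<odot>\<^bsub>A\<^esub> x) \<oplus>\<^bsub>A\<^esub> (c \<odot>\<^bsub>A\<^esub> y)"
    and "\<And>c d x. \<lbrakk>c \<in> carrier K; d \<in> carrier K; x \<in> carrier A\<rbrakk> \<Longrightarrow>
      (c \<otimes> d) \<odot>\<^bsub>A\<^esub> x = c \<odot>\<^bsub>A\<^esub> (d \<odot>\<^bsub>A\<^esub> x)"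
    and "\<And>x. x \<in> carrier A \<Longrightarrow> \<one> \<odot>\<^bsub>A\<^esub> x = x"
    and "\<And>c x y. \<lbrakk>c \<in> carrier K; x \<in> carrier A; y \<in> carrier A\<rbrakk> \<Longrightarrow>
      (c \<odot>\<^bsub>A\<^esub> x) \<otimes>\<^bsub>A\<^esub> y = c \<odot>\<^bsub>A\<^esub> (x \<otimes>\<^bsub>A\<^esub> y)"
    and "\<And>c x y. \<lbrakk>c \<in> carrier K; x \<in> carrier A; y \<in> carrier A\<rbrakk> \<Longrightarrow>
      x \<otimes>\<^bsub>A\<^esub> (c \<odot>\<^bsub>A\<^esub> y) = c \<odot>\<^bsub>A\<^esub> (x \<otimes>\<^bsub>A\<^esub> y)"
  shows "assoc_algebra K A"
  by (intro assoc_algebra.intro assoc_algebra_axioms.intro moduleI assms ringE(1))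

text \<open>Taking the constant coefficient of a Laurent polynomial is linear but not
  multiplicative, so the projection \<open>\<pi>\<close> needs a notion weaker than
  \<open>alg_hom\<close>.\<close>

definition linear_maps ::
    "('k, 'e) ring_scheme \<Rightarrow> ('k, 'a, 'c) module_scheme \<Rightarrow> ('k, 'b, 'd) module_scheme \<Rightarrow> ('a \<Rightarrow> 'b) set"
  where "linear_maps K V W =
    {h \<in> carrier V \<rightarrow> carrier W.
      (\<forall>x\<in>carrier V. \<forall>y\<in>carrier V. h (x \<oplus>\<^bsub>V\<^esub> y) = h x \<oplus>\<^bsub>W\<^esub> h y) \<and>
      (\<forall>c\<in>carrier K. \<forall>x\<in>carrier V. h (c \<odot>\<^bsub>V\<^esub> x) = c \<odot>\<^bsub>W\<^esub> h x)}"

lemma linear_mapsD: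
  assumes "h \<in> linear_maps K V W"
  shows "x \<in> carrier V \<Longrightarrow> h x \<in> carrier W"
    and "\<lbrakk>x \<in> carrier V; y \<in> carrier V\<rbrakk> \<Longrightarrow> h (x \<oplus>\<^bsub>V\<^esub> y) = h x \<oplus>\<^bsub>W\<^esub> h y"
    and "\<lbrakk>c \<in> carrier K; x \<in> carrier V\<rbrakk> \<Longrightarrow> h (c \<odot>\<^bsub>V\<^esub> x) = c \<odot>\<^bsub>W\<^esub> h x"
  using assms by (auto simp: linear_maps_def)

lemma alg_homD:
  assumes "h \<in> alg_hom K A B"
  shows "x \<in> carrier A \<Longrightarrow> h x \<in> carrier B"
    and "\<lbrakk>x \<in> carrier A; y \<in> carrier A\<rbrakk> \<Longrightarrow> h (x \<oplus>\<^bsub>A\<^esub> y) = h x \<oplus>\<^bsub>B\<^esub> h y"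
    and "\<lbrakk>c \<in> carrier K; x \<in> carrier A\<rbrakk> \<Longrightarrow> h (c \<odot>\<^bsub>A\<^esub> x) = c \<odot>\<^bsub>B\<^esub> h x"
    and "\<lbrakk>x \<in> carrier A; y \<in> carrier A\<rbrakk> \<Longrightarrow> h (x \<otimes>\<^bsub>A\<^esub> y) = h x \<otimes>\<^bsub>B\<^esub> h y"
    and "h \<one>\<^bsub>A\<^esub> = \<one>\<^bsub>B\<^esub>"
  using assms by (auto simp: alg_hom_def ring_hom_def)

lemma linear_maps_zero:
  assumes "h \<in> linear_maps K V W" "module K V" "module K W"
  shows "h \<zero>\<^bsub>V\<^esub> = \<zero>\<^bsub>W\<^esub>"
proof -
  interpret V: module K V by fact
  interpret W: module K W by fact
  have "h \<zero>\<^bsub>V\<^esub> = h (\<zero>\<^bsub>K\<^esub> \<odot>\<^bsub>V\<^esub> \<zero>\<^bsub>V\<^esub>)" by simp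
  also have "\<dots> = \<zero>\<^bsub>W\<^esub>"
    using linear_mapsD[OF assms(1)] by (metis V.R.zero_closed V.M.zero_closed W.smult_l_null)
  finally show ?thesis .
qed

section \<open>Monoid algebras: convolution, spanning by basis elements, linear extension\<close>

lemma monoid_algebra_simps [simp]:
  "\<zero>\<^bsub>monoid_algebra K M\<^esub> = (\<lambda>x. \<zero>\<^bsub>K\<^esub>)"
  "\<one>\<^bsub>monoid_algebra K M\<^esub> = basis_elem K \<one>\<^bsub>M\<^esub>"
  "f \<oplus>\<^bsub>monoid_algebra K M\<^esub> g = (\<lambda>x. f x \<oplus>\<^bsub>K\<^esub> g x)"
  "c \<odot>\<^bsub>monoid_algebra K M\<^esub> f = (\<lambda>x. c \<otimes>\<^bsub>K\<^esub> f x)"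
  by (simp_all add: monoid_algebra_def basis_elem_def)

lemma monoid_algebra_mult:
  "(f \<otimes>\<^bsub>monoid_algebra K M\<^esub> g) x = finsum K (\<lambda>(a, b). f a \<otimes>\<^bsub>K\<^esub> g b)
    {(a, b). f a \<noteq> \<zero>\<^bsub>K\<^esub> \<and> g b \<noteq> \<zero>\<^bsub>K\<^esub> \<and> a \<otimes>\<^bsub>M\<^esub> b = x}"
  by (simp add: monoid_algebra_def)

locale monoid_alg = R?: cring K + M: monoid M for K (structure) and M (structure)
begin

abbreviation "KM \<equiv> monoid_algebra K M"
abbreviation "bas \<equiv> basis_elem K"

lemma carrier_KM: "f \<in> carrier KM \<longleftrightarrow>
    (\<forall>x. f x \<in> carrier K) \<and> finite {x. f x \<noteq> \<zero>} \<and> {x. f x \<noteq> \<zero>} \<subseteq> carrier M"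
  by (simp add: monoid_algebra_def)

lemma coeff_closed: "f \<in> carrier KM \<Longrightarrow> f x \<in> carrier K"
  by (simp add: carrier_KM)

lemma supp_finite [simp]: "f \<in> carrier KM \<Longrightarrow> finite {x. f x \<noteq> \<zero>}"
  by (simp add: carrier_KM)

lemma supp_carrier: "\<lbrakk>f \<in> carrier KM; f x \<noteq> \<zero>\<rbrakk> \<Longrightarrow> x \<in> carrier M"
  by (auto simp: carrier_KM)

lemma carrier_KMI:
  assumes "\<And>x. f x \<in> carrier K" "finite S" "S \<subseteq> carrier M" "\<And>x. x \<notin> S \<Longrightarrow> f x = \<zero>"
  shows "f \<in> carrier KM"
proof -
  have "{x. f x \<noteq> \<zero>} \<subseteq> S" using assms(4) by blast
  with assms(1-3) show ?thesis by (auto simp: carrier_KM intro: finite_subset)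
qed

lemma basis_closed [simp]: "a \<in> carrier M \<Longrightarrow> bas a \<in> carrier KM"
  by (rule carrier_KMI[of _ "{a}"]) (auto simp: basis_elem_def)

lemma supp_basis: "{x. bas a x \<noteq> \<zero>} \<subseteq> {a}"
  by (auto simp: basis_elem_def)

lemma zero_fun_closed [simp]: "(\<lambda>x. \<zero>) \<in> carrier KM"
  by (rule carrier_KMI[of _ "{}"]) auto

lemma add_fun_closed [simp]:
  assumes "f \<in> carrier KM" "g \<in> carrier KM"
  shows "(\<lambda>x. f x \<oplus> g x) \<in> carrier KM"
  by (rule carrier_KMI[of _ "{x. f x \<noteq> \<zero>} \<union> {x. g x \<noteq> \<zero>}"])
    (use assms assms[THEN coeff_closed] in \<open>auto intro: supp_carrier\<close>)

lemma smult_fun_closed [simp]: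
  assumes "c \<in> carrier K" "f \<in> carrier KM"
  shows "(\<lambda>x. c \<otimes> f x) \<in> carrier KM"
  by (rule carrier_KMI[of _ "{x. f x \<noteq> \<zero>}"])
    (use assms coeff_closed[OF assms(2)] in \<open>auto intro: supp_carrier\<close>)

text \<open>A finitely supported function is a linear combination of basis elements: induct on a
  finite set containing the support, splitting off one coefficient at a time. Every statement that
  is linear in \<open>f\<close> is thereby reduced to basis elements.\<close>

lemma KM_induct [consumes 1, case_names basis smult add]:
  assumes f: "f \<in> carrier KM"
    and basis: "\<And>a. a \<in> carrier M \<Longrightarrow> P (bas a)"
    and smult: "\<And>c f. \<lbrakk>c \<in> carrier K; f \<in> carrier KM; P f\<rbrakk> \<Longrightarrow> P (\<lambda>x. c \<otimes> f x)"
    and add: "\<And>f g. \<lbrakk>f \<in> carrier KM; g \<in> carrier KM; P f; P g\<rbrakk> \<Longrightarrow> P (\<lambda>x. f x \<oplus> g x)"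
  shows "P f"
proof -
  have "P f" if "finite S" "f \<in> carrier KM" "{x. f x \<noteq> \<zero>} \<subseteq> S" for S f
    using that
  proof (induction S arbitrary: f rule: finite_induct)
    case empty
    \<comment> \<open>There is no separate case for zero, so the zero function is presented as the
      zero multiple of the basis element of the unit of \<open>M\<close>.\<close>
    then have eq: "f = (\<lambda>x. \<zero> \<otimes> bas \<one>\<^bsub>M\<^esub> x)" by (auto simp: basis_elem_def)
    show ?case by (subst eq, rule smult) (auto intro: basis)
  next
    case (insert a S)
    show ?case
    proof (cases "f a = \<zero>")
      case True
      show ?thesis by (rule insert.IH) (use insert.prems True in auto)
    next
      case False
      then have a: "a \<in> carrier M" using insert.prems(1) supp_carrier by blast
      let ?g = "\<lambda>x. if x = a then \<zero> else f x"
      have g: "?g \<in> carrier KM"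
        by (rule carrier_KMI[of _ "{x. f x \<noteq> \<zero>}"])
          (use insert.prems coeff_closed[OF insert.prems(1)] in \<open>auto intro: supp_carrier\<close>)
      have g': "P ?g" by (rule insert.IH) (use g insert.prems in auto)
      have fa: "f a \<in> carrier K" using insert.prems(1) by (rule coeff_closed)
      have eq: "f = (\<lambda>x. (f a \<otimes> bas a x) \<oplus> ?g x)"
        using coeff_closed[OF insert.prems(1)] by (auto simp: basis_elem_def)
      show ?thesis
        by (subst eq, rule add[OF _ g smult[OF fa _ basis] g']) (use fa a in simp_all)
    qed
  qed
  from this[OF supp_finite[OF f] f subset_refl] show ?thesis .
qed

text \<open>The index set in the definition of the product depends on the exact supports of
  \<open>f\<close> and \<open>g\<close>. Moving to a finite rectangle \<open>S \<times> S'\<close>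
  that contains them, with zero terms added, lets products of different functions be compared term
  by term over one common index set.\<close>

lemma mult_eq_finsum:
  assumes "f \<in> carrier KM" "g \<in> carrier KM" "finite S" "finite S'"
    and "{x. f x \<noteq> \<zero>} \<subseteq> S" "{x. g x \<noteq> \<zero>} \<subseteq> S'"
  shows "(f \<otimes>\<^bsub>KM\<^esub> g) x =
    (\<Oplus>p\<in>S \<times> S'. if fst p \<otimes>\<^bsub>M\<^esub> snd p = x then f (fst p) \<otimes> g (snd p) else \<zero>)"
proof -
  note [simp] = assms(1,2)[THEN coeff_closed]
  have "(f \<otimes>\<^bsub>KM\<^esub> g) x = finsum K (\<lambda>(a, b). f a \<otimes> g b)
      {(a, b). f a \<noteq> \<zero> \<and> g b \<noteq> \<zero> \<and> a \<otimes>\<^bsub>M\<^esub> b = x}"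
    by (rule monoid_algebra_mult)
  also have "\<dots> = (\<Oplus>p\<in>S \<times> S'. if fst p \<otimes>\<^bsub>M\<^esub> snd p = x then f (fst p) \<otimes> g (snd p) else \<zero>)"
  proof (rule R.add.finprod_mono_neutral_cong_left)
    show "finite (S \<times> S')" using assms(3,4) by simp
    show "{(a, b). f a \<noteq> \<zero> \<and> g b \<noteq> \<zero> \<and> a \<otimes>\<^bsub>M\<^esub> b = x} \<subseteq> S \<times> S'"
      using assms(5,6) by blast
  qed (auto simp: split_def)
  finally show ?thesis .
qed

lemma mult_fun_closed [simp]:
  assumes f: "f \<in> carrier KM" and g: "g \<in> carrier KM"
  shows "f \<otimes>\<^bsub>KM\<^esub> g \<in> carrier KM"
proof -
  note [simp] = f[THEN coeff_closed] g[THEN coeff_closed]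
  let ?S = "{x. f x \<noteq> \<zero>}" and ?S' = "{x. g x \<noteq> \<zero>}"
  note eq = mult_eq_finsum[OF f g supp_finite[OF f] supp_finite[OF g] subset_refl subset_refl]
  show ?thesis
  proof (rule carrier_KMI[of _ "(\<lambda>(a, b). a \<otimes>\<^bsub>M\<^esub> b) ` (?S \<times> ?S')"])
    show "(f \<otimes>\<^bsub>KM\<^esub> g) x \<in> carrier K" for x
      unfolding eq by (rule R.finsum_closed) (use f g in auto)
    show "(f \<otimes>\<^bsub>KM\<^esub> g) x = \<zero>" if "x \<notin> (\<lambda>(a, b). a \<otimes>\<^bsub>M\<^esub> b) ` (?S \<times> ?S')" for x
    proof -
      have "(f \<otimes>\<^bsub>KM\<^esub> g) x = (\<Oplus>p\<in>?S \<times> ?S'. \<zero>)"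
        unfolding eq by (rule R.finsum_cong') (use that in auto)
      then show ?thesis by simp
    qed
  qed (use f g in \<open>auto intro: supp_carrier\<close>)
qed

lemma mult_basis:
  assumes "a \<in> carrier M" "b \<in> carrier M"
  shows "bas a \<otimes>\<^bsub>KM\<^esub> bas b = bas (a \<otimes>\<^bsub>M\<^esub> b)"
proof
  fix x
  have "(bas a \<otimes>\<^bsub>KM\<^esub> bas b) x = (\<Oplus>p\<in>{(a, b)}.
      if fst p \<otimes>\<^bsub>M\<^esub> snd p = x then bas a (fst p) \<otimes> bas b (snd p) else \<zero>)"
    using mult_eq_finsum[OF assms[THEN basis_closed] _ _ supp_basis supp_basis] by simp
  also have "\<dots> = bas (a \<otimes>\<^bsub>M\<^esub> b) x"
    by (subst R.finsum_insert) (auto simp: basis_elem_def)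
  finally show "(bas a \<otimes>\<^bsub>KM\<^esub> bas b) x = bas (a \<otimes>\<^bsub>M\<^esub> b) x" .
qed

lemma mult_add_l:
  assumes "f \<in> carrier KM" "g \<in> carrier KM" "h \<in> carrier KM"
  shows "(\<lambda>x. f x \<oplus> g x) \<otimes>\<^bsub>KM\<^esub> h = (\<lambda>x. (f \<otimes>\<^bsub>KM\<^esub> h) x \<oplus> (g \<otimes>\<^bsub>KM\<^esub> h) x)"
proof
  note [simp] = assms[THEN coeff_closed]
  fix x
  let ?S = "{x. f x \<noteq> \<zero>} \<union> {x. g x \<noteq> \<zero>}" and ?S' = "{x. h x \<noteq> \<zero>}"
  have "((\<lambda>x. f x \<oplus> g x) \<otimes>\<^bsub>KM\<^esub> h) x = (\<Oplus>p\<in>?S \<times> ?S'.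
      if fst p \<otimes>\<^bsub>M\<^esub> snd p = x then (f (fst p) \<oplus> g (fst p)) \<otimes> h (snd p) else \<zero>)"
    by (rule mult_eq_finsum) (use assms in auto)
  also have "\<dots> = (\<Oplus>p\<in>?S \<times> ?S'.
      (if fst p \<otimes>\<^bsub>M\<^esub> snd p = x then f (fst p) \<otimes> h (snd p) else \<zero>) \<oplus>
      (if fst p \<otimes>\<^bsub>M\<^esub> snd p = x then g (fst p) \<otimes> h (snd p) else \<zero>))"
    by (rule R.finsum_cong') (use assms in \<open>auto simp: R.l_distr\<close>)
  also have "\<dots> = (f \<otimes>\<^bsub>KM\<^esub> h) x \<oplus> (g \<otimes>\<^bsub>KM\<^esub> h) x"
    by (subst R.finsum_addf)
      (use assms in \<open>auto simp: mult_eq_finsum[where S = ?S and S' = ?S']\<close>)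
  finally show "((\<lambda>x. f x \<oplus> g x) \<otimes>\<^bsub>KM\<^esub> h) x = (f \<otimes>\<^bsub>KM\<^esub> h) x \<oplus> (g \<otimes>\<^bsub>KM\<^esub> h) x" .
qed

lemma mult_add_r:
  assumes "f \<in> carrier KM" "g \<in> carrier KM" "h \<in> carrier KM"
  shows "h \<otimes>\<^bsub>KM\<^esub> (\<lambda>x. f x \<oplus> g x) = (\<lambda>x. (h \<otimes>\<^bsub>KM\<^esub> f) x \<oplus> (h \<otimes>\<^bsub>KM\<^esub> g) x)"
proof
  note [simp] = assms[THEN coeff_closed]
  fix x
  let ?S = "{x. f x \<noteq> \<zero>} \<union> {x. g x \<noteq> \<zero>}" and ?S' = "{x. h x \<noteq> \<zero>}"
  have "(h \<otimes>\<^bsub>KM\<^esub> (\<lambda>x. f x \<oplus> g x)) x = (\<Oplus>p\<in>?S' \<times> ?S.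
      if fst p \<otimes>\<^bsub>M\<^esub> snd p = x then h (fst p) \<otimes> (f (snd p) \<oplus> g (snd p)) else \<zero>)"
    by (rule mult_eq_finsum) (use assms in auto)
  also have "\<dots> = (\<Oplus>p\<in>?S' \<times> ?S.
      (if fst p \<otimes>\<^bsub>M\<^esub> snd p = x then h (fst p) \<otimes> f (snd p) else \<zero>) \<oplus>
      (if fst p \<otimes>\<^bsub>M\<^esub> snd p = x then h (fst p) \<otimes> g (snd p) else \<zero>))"
    by (rule R.finsum_cong') (use assms in \<open>auto simp: R.r_distr\<close>)
  also have "\<dots> = (h \<otimes>\<^bsub>KM\<^esub> f) x \<oplus> (h \<otimes>\<^bsub>KM\<^esub> g) x"
    by (subst R.finsum_addf)
      (use assms in \<open>auto simp: mult_eq_finsum[where S = ?S' and S' = ?S]\<close>)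
  finally show "(h \<otimes>\<^bsub>KM\<^esub> (\<lambda>x. f x \<oplus> g x)) x = (h \<otimes>\<^bsub>KM\<^esub> f) x \<oplus> (h \<otimes>\<^bsub>KM\<^esub> g) x" .
qed

lemma mult_smult_l:
  assumes "c \<in> carrier K" "f \<in> carrier KM" "g \<in> carrier KM"
  shows "(\<lambda>x. c \<otimes> f x) \<otimes>\<^bsub>KM\<^esub> g = (\<lambda>x. c \<otimes> (f \<otimes>\<^bsub>KM\<^esub> g) x)"
proof
  note [simp] = assms(2,3)[THEN coeff_closed]
  fix x
  let ?S = "{x. f x \<noteq> \<zero>}" and ?S' = "{x. g x \<noteq> \<zero>}"
  have "((\<lambda>x. c \<otimes> f x) \<otimes>\<^bsub>KM\<^esub> g) x = (\<Oplus>p\<in>?S \<times> ?S'.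
      if fst p \<otimes>\<^bsub>M\<^esub> snd p = x then c \<otimes> f (fst p) \<otimes> g (snd p) else \<zero>)"
    by (rule mult_eq_finsum) (use assms in auto)
  also have "\<dots> = (\<Oplus>p\<in>?S \<times> ?S'.
      c \<otimes> (if fst p \<otimes>\<^bsub>M\<^esub> snd p = x then f (fst p) \<otimes> g (snd p) else \<zero>))"
    by (rule R.finsum_cong') (use assms in \<open>auto simp: R.m_assoc\<close>)
  also have "\<dots> = c \<otimes> (f \<otimes>\<^bsub>KM\<^esub> g) x"
    by (subst R.finsum_rdistr[symmetric])
      (use assms in \<open>auto simp: mult_eq_finsum[where S = ?S and S' = ?S']\<close>)
  finally show "((\<lambda>x. c \<otimes> f x) \<otimes>\<^bsub>KM\<^esub> g) x = c \<otimes> (f \<otimes>\<^bsub>KM\<^esub> g) x" .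
qed

lemma mult_smult_r:
  assumes "c \<in> carrier K" "f \<in> carrier KM" "g \<in> carrier KM"
  shows "f \<otimes>\<^bsub>KM\<^esub> (\<lambda>x. c \<otimes> g x) = (\<lambda>x. c \<otimes> (f \<otimes>\<^bsub>KM\<^esub> g) x)"
proof
  note [simp] = assms(2,3)[THEN coeff_closed]
  fix x
  let ?S = "{x. f x \<noteq> \<zero>}" and ?S' = "{x. g x \<noteq> \<zero>}"
  have "(f \<otimes>\<^bsub>KM\<^esub> (\<lambda>x. c \<otimes> g x)) x = (\<Oplus>p\<in>?S \<times> ?S'.
      if fst p \<otimes>\<^bsub>M\<^esub> snd p = x then f (fst p) \<otimes> (c \<otimes> g (snd p)) else \<zero>)"
    by (rule mult_eq_finsum) (use assms in auto)
  also have "\<dots> = (\<Oplus>p\<in>?S \<times> ?S'.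
      c \<otimes> (if fst p \<otimes>\<^bsub>M\<^esub> snd p = x then f (fst p) \<otimes> g (snd p) else \<zero>))"
    by (rule R.finsum_cong') (use assms in \<open>auto simp: R.m_lcomm\<close>)
  also have "\<dots> = c \<otimes> (f \<otimes>\<^bsub>KM\<^esub> g) x"
    by (subst R.finsum_rdistr[symmetric])
      (use assms in \<open>auto simp: mult_eq_finsum[where S = ?S and S' = ?S']\<close>)
  finally show "(f \<otimes>\<^bsub>KM\<^esub> (\<lambda>x. c \<otimes> g x)) x = c \<otimes> (f \<otimes>\<^bsub>KM\<^esub> g) x" .
qed

lemmas mult_linear = mult_add_l mult_add_r mult_smult_l mult_smult_r

text \<open>Both sides are linear in each of the three factors, so three nested inductions leave
  only basis elements, where the claim is associativity in \<open>M\<close>.\<close>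

lemma mult_fun_assoc:
  assumes f: "f \<in> carrier KM" and g: "g \<in> carrier KM" and h: "h \<in> carrier KM"
  shows "f \<otimes>\<^bsub>KM\<^esub> g \<otimes>\<^bsub>KM\<^esub> h = f \<otimes>\<^bsub>KM\<^esub> (g \<otimes>\<^bsub>KM\<^esub> h)"
  using f
proof (induction f rule: KM_induct)
  case (basis a)
  show ?case using g
  proof (induction g rule: KM_induct)
    case (basis b)
    show ?case using h
      by (induction h rule: KM_induct)
        (simp_all add: mult_basis mult_linear M.m_assoc \<open>a \<in> _\<close> basis)
  qed (simp_all add: mult_linear h basis)
qed (simp_all add: mult_linear g h)

lemma monoid_algebra_ring: "ring KM"
proof (rule ringI)
  show "abelian_group KM"
  proof (rule abelian_groupI)
    fix f assume f: "f \<in> carrier KM"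
    have "(\<lambda>x. \<ominus> \<one> \<otimes> f x) \<oplus>\<^bsub>KM\<^esub> f = \<zero>\<^bsub>KM\<^esub>"
      using f[THEN coeff_closed] by (auto simp: R.l_minus R.l_neg)
    then show "\<exists>g\<in>carrier KM. g \<oplus>\<^bsub>KM\<^esub> f = \<zero>\<^bsub>KM\<^esub>"
      using f smult_fun_closed by (meson R.a_inv_closed R.one_closed)
  qed (simp_all add: R.a_ac coeff_closed)
  show "Group.monoid KM"
  proof (rule monoidI)
    fix f assume "f \<in> carrier KM"
    then show "\<one>\<^bsub>KM\<^esub> \<otimes>\<^bsub>KM\<^esub> f = f" "f \<otimes>\<^bsub>KM\<^esub> \<one>\<^bsub>KM\<^esub> = f"
      by (induction f rule: KM_induct) (simp_all add: mult_basis mult_linear)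
  qed (simp_all add: mult_fun_assoc)
qed (simp_all add: mult_linear)

lemma monoid_algebra_assoc: "assoc_algebra K KM"
  by (rule assoc_algebraI)
    (simp_all add: R.is_cring monoid_algebra_ring mult_linear R.l_distr R.r_distr R.m_assoc
      coeff_closed)

text \<open>Freeness of the underlying vector space: \<open>\<phi>\<close> is an arbitrary function
  into a module, not assumed multiplicative, and \<open>M\<close> serves only as an index set for
  the basis.\<close>

lemma linear_extension:
  fixes V (structure)
  assumes V: "module K V" and \<phi>: "\<phi> \<in> carrier M \<rightarrow> carrier V"
  obtains h where "h \<in> linear_maps K KM V" "\<And>a. a \<in> carrier M \<Longrightarrow> h (bas a) = \<phi> a"
proof
  interpret V: module K V by (fact V)
  note [simp] = funcset_mem[OF \<phi>]
  define h where "h = (\<lambda>f. \<Oplus>\<^bsub>V\<^esub>a\<in>{a. f a \<noteq> \<zero>}. f a \<odot>\<^bsub>V\<^esub> \<phi> a)"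
  \<comment> \<open>Supports can shrink through cancellation when functions are added, so the
    defining sum has to be available over any finite set between the support and
    \<open>carrier M\<close>; staying inside the carrier keeps the values of \<open>\<phi>\<close>
    in \<open>V\<close>.\<close>
  have h_eq: "h f = (\<Oplus>\<^bsub>V\<^esub>a\<in>S. f a \<odot>\<^bsub>V\<^esub> \<phi> a)"
    if "f \<in> carrier KM" "finite S" "{a. f a \<noteq> \<zero>} \<subseteq> S" "S \<subseteq> carrier M" for f S
    unfolding h_def
    by (rule V.M.add.finprod_mono_neutral_cong_left)
      (use that coeff_closed[OF that(1)] in \<open>auto simp: subset_iff\<close>)
  have supp: "{a. f a \<noteq> \<zero>} \<subseteq> carrier M" if "f \<in> carrier KM" for f
    using that by (simp add: carrier_KM)
  show "h \<in> linear_maps K KM V"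
    unfolding linear_maps_def
  proof (intro CollectI conjI ballI Pi_I)
    fix f assume f: "f \<in> carrier KM"
    note [simp] = coeff_closed[OF f]
    show "h f \<in> carrier V"
      unfolding h_def by (rule V.M.finsum_closed) (use f supp[OF f] in \<open>auto simp: subset_iff\<close>)
    fix g assume g: "g \<in> carrier KM"
    note [simp] = coeff_closed[OF g]
    let ?S = "{a. f a \<noteq> \<zero>} \<union> {a. g a \<noteq> \<zero>}"
    have fg: "f \<oplus>\<^bsub>KM\<^esub> g \<in> carrier KM"
      using f g by simp
    have sub: "{a. (f \<oplus>\<^bsub>KM\<^esub> g) a \<noteq> \<zero>} \<subseteq> ?S" "?S \<subseteq> carrier M"
      using supp[OF f] supp[OF g] by auto
    have "h (f \<oplus>\<^bsub>KM\<^esub> g) = (\<Oplus>\<^bsub>V\<^esub>a\<in>?S. (f a \<oplus> g a) \<odot>\<^bsub>V\<^esub> \<phi> a)"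
      using h_eq[OF fg _ sub(1,2)] f g by simp
    also have "\<dots> = (\<Oplus>\<^bsub>V\<^esub>a\<in>?S. f a \<odot>\<^bsub>V\<^esub> \<phi> a \<oplus>\<^bsub>V\<^esub> g a \<odot>\<^bsub>V\<^esub> \<phi> a)"
      by (rule V.M.finsum_cong')
        (use f g supp[OF f] supp[OF g] in \<open>auto simp: subset_iff intro!: V.smult_l_distr\<close>)
    also have "\<dots> = (\<Oplus>\<^bsub>V\<^esub>a\<in>?S. f a \<odot>\<^bsub>V\<^esub> \<phi> a) \<oplus>\<^bsub>V\<^esub> (\<Oplus>\<^bsub>V\<^esub>a\<in>?S. g a \<odot>\<^bsub>V\<^esub> \<phi> a)"
      by (rule V.M.finsum_addf) (use f g supp[OF f] supp[OF g] in \<open>auto simp: subset_iff\<close>)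
    also have "\<dots> = h f \<oplus>\<^bsub>V\<^esub> h g"
      using h_eq[OF f _ _ sub(2)] h_eq[OF g _ _ sub(2)] f g by simp
    finally show "h (f \<oplus>\<^bsub>KM\<^esub> g) = h f \<oplus>\<^bsub>V\<^esub> h g" .
  next
    fix c f assume c: "c \<in> carrier K" and f: "f \<in> carrier KM"
    note [simp] = coeff_closed[OF f]
    let ?S = "{a. f a \<noteq> \<zero>}"
    have sub: "{a. c \<otimes> f a \<noteq> \<zero>} \<subseteq> ?S"
      using c by auto
    have "h (c \<odot>\<^bsub>KM\<^esub> f) = (\<Oplus>\<^bsub>V\<^esub>a\<in>?S. (c \<otimes> f a) \<odot>\<^bsub>V\<^esub> \<phi> a)"
      using h_eq[OF smult_fun_closed[OF c f] _ sub supp[OF f]] f by simp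
    also have "\<dots> = (\<Oplus>\<^bsub>V\<^esub>a\<in>?S. c \<odot>\<^bsub>V\<^esub> (f a \<odot>\<^bsub>V\<^esub> \<phi> a))"
      by (rule V.M.finsum_cong')
        (use c f supp[OF f] in \<open>auto simp: subset_iff intro!: V.smult_assoc1\<close>)
    also have "\<dots> = c \<odot>\<^bsub>V\<^esub> h f"
      unfolding h_def
      by (rule V.finsum_smult_ldistr[symmetric]) (use c f supp[OF f] in \<open>auto simp: subset_iff\<close>)
    finally show "h (c \<odot>\<^bsub>KM\<^esub> f) = c \<odot>\<^bsub>V\<^esub> h f" .
  qed
  show "h (bas a) = \<phi> a" if "a \<in> carrier M" for a
  proof -
    have "h (bas a) = (\<Oplus>\<^bsub>V\<^esub>b\<in>{a}. bas a b \<odot>\<^bsub>V\<^esub> \<phi> b)"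
      by (rule h_eq[OF basis_closed[OF that] _ supp_basis]) (use that in auto)
    also have "\<dots> = \<phi> a"
      using that by (subst V.M.finsum_insert) (simp_all add: basis_elem_def)
    finally show ?thesis .
  qed
qed

end

section \<open>Quotients by relations\<close>

text \<open>Scalar multiplication of cosets is defined as a union over all representatives. The
  union is a single coset because a ring ideal absorbs scalars: a scalar multiple of
  \<open>i\<close> is the product of the same multiple of the unit with \<open>i\<close>.\<close>

lemma (in assoc_algebra) quot_smult:
  assumes "ideal I A" "c \<in> carrier K" "x \<in> carrier A"
  shows "(\<Union>a\<in>I +>\<^bsub>A\<^esub> x. I +>\<^bsub>A\<^esub> (c \<odot>\<^bsub>A\<^esub> a)) = I +>\<^bsub>A\<^esub> (c \<odot>\<^bsub>A\<^esub> x)"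
proof -
  interpret I: ideal I A by fact
  have "I +>\<^bsub>A\<^esub> (c \<odot>\<^bsub>A\<^esub> a) = I +>\<^bsub>A\<^esub> (c \<odot>\<^bsub>A\<^esub> x)" if a: "a \<in> I +>\<^bsub>A\<^esub> x" for a
  proof -
    obtain i where i: "i \<in> I" "a = i \<oplus>\<^bsub>A\<^esub> x"
      using a by (auto simp: a_r_coset_def r_coset_def)
    have ci: "i \<in> carrier A" using i I.Icarr by blast
    have "c \<odot>\<^bsub>A\<^esub> i = (c \<odot>\<^bsub>A\<^esub> \<one>\<^bsub>A\<^esub>) \<otimes>\<^bsub>A\<^esub> i"
      using ci assms by (simp add: smult_mult_l)
    then have "c \<odot>\<^bsub>A\<^esub> i \<in> I"
      using I.I_l_closed i assms by simp
    moreover have "c \<odot>\<^bsub>A\<^esub> a = c \<odot>\<^bsub>A\<^esub> i \<oplus>\<^bsub>A\<^esub> c \<odot>\<^bsub>A\<^esub> x"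
      using i ci assms by (simp add: smult_r_distr)
    ultimately have "c \<odot>\<^bsub>A\<^esub> a \<in> I +>\<^bsub>A\<^esub> (c \<odot>\<^bsub>A\<^esub> x)"
      by (auto simp: a_r_coset_def r_coset_def)
    then show ?thesis
      by (metis M.a_repr_independence I.a_subgroup assms(2,3) smult_closed)
  qed
  moreover have "x \<in> I +>\<^bsub>A\<^esub> x"
    using I.a_rcos_self assms by blast
  ultimately show ?thesis by blast
qed

lemma (in assoc_algebra) quot_class_alg_hom:
  assumes "ideal I A"
  shows "(+>\<^bsub>A\<^esub>) I \<in> alg_hom K A (quot_algebra A I)"
proof -
  interpret I: ideal I A by fact
  show ?thesis
    using I.rcos_ring_hom assms
    by (auto simp: alg_hom_def quot_algebra_def ring_hom_def quot_smult)
qed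

lemma (in assoc_algebra) carrier_quot_algebra:
  "carrier (quot_algebra A I) = (+>\<^bsub>A\<^esub>) I ` carrier A"
  by (auto simp: quot_algebra_def FactRing_simps)

lemma (in assoc_algebra) quot_algebra_assoc:
  assumes I: "ideal I A"
  shows "assoc_algebra K (quot_algebra A I)"
proof -
  interpret I: ideal I A by fact
  let ?Q = "quot_algebra A I"
  interpret AI: ring "A Quot I" by (rule I.quotient_is_ring)
  have quot_simps [simp]: "carrier ?Q = carrier (A Quot I)" "mult ?Q = mult (A Quot I)" "one ?Q = one (A Quot I)"
    "zero ?Q = zero (A Quot I)" "add ?Q = add (A Quot I)"
    by (simp_all add: quot_algebra_def)
  have Q: "ring ?Q"
  proof (intro ringI abelian_groupI monoidI)
    fix x assume "x \<in> carrier ?Q"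
    then show "\<exists>y\<in>carrier ?Q. y \<oplus>\<^bsub>?Q\<^esub> x = \<zero>\<^bsub>?Q\<^esub>"
      using AI.add.inv_closed AI.l_neg by auto
  qed (simp_all add: AI.a_ac AI.m_assoc AI.l_distr AI.r_distr)
  \<comment> \<open>Read from right to left, the homomorphism laws turn each expression in cosets
    into the coset of an expression in \<open>A\<close>, so the algebra laws descend along the
    surjection.\<close>
  note hom = alg_homD(2-5)[OF quot_class_alg_hom[OF I], symmetric]
  show ?thesis
    by (rule assoc_algebraI)
      (auto simp del: quot_simps simp: Q R.is_cring carrier_quot_algebra hom smult_mult_l smult_mult_r smult_l_distr
        smult_r_distr smult_assoc1)
qed

locale presented_algebra = assoc_algebra K A for K (structure) and A (structure) +
  fixes R :: "('b \<times> 'b) set"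
  assumes rels_carrier: "R \<subseteq> carrier A \<times> carrier A"
begin

lemma rels_diff_carrier: "(\<lambda>(l, r). l \<ominus>\<^bsub>A\<^esub> r) ` R \<subseteq> carrier A"
  using rels_carrier by auto

lemma rel_ideal: "ideal (rel_ideal A R) A"
  unfolding rel_ideal_def by (rule A.genideal_ideal[OF rels_diff_carrier])

lemma quot_rels_assoc: "assoc_algebra K (quot_rels A R)"
  unfolding quot_rels_def by (rule quot_algebra_assoc[OF rel_ideal])

lemma quot_class_hom: "quot_class A R \<in> alg_hom K A (quot_rels A R)"
  unfolding quot_rels_def quot_class_def[abs_def] by (rule quot_class_alg_hom[OF rel_ideal])

lemma carrier_quot_rels: "carrier (quot_rels A R) = quot_class A R ` carrier A"
  by (simp add: quot_rels_def carrier_quot_algebra quot_class_def)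

lemma quot_class_eq_iff:
  assumes "a \<in> carrier A" "b \<in> carrier A"
  shows "quot_class A R a = quot_class A R b \<longleftrightarrow> a \<ominus>\<^bsub>A\<^esub> b \<in> rel_ideal A R"
  unfolding quot_class_def
  by (rule A.quotient_eq_iff_same_a_r_cos[OF rel_ideal assms, symmetric])

lemma quot_class_rel:
  assumes "(l, r) \<in> R"
  shows "quot_class A R l = quot_class A R r"
proof -
  have "l \<ominus>\<^bsub>A\<^esub> r \<in> rel_ideal A R"
    using A.genideal_self[OF rels_diff_carrier] assms by (force simp: rel_ideal_def)
  then show ?thesis
    using assms rels_carrier by (subst quot_class_eq_iff) auto
qed

text \<open>Since \<open>h\<close> is only linear, agreement on \<open>l\<close> and
  \<open>r\<close> would not make it vanish on the two-sided ideal they generate. Hence agreement is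
  demanded after multiplication by arbitrary elements on both sides.\<close>

lemma quot_rels_lift:
  fixes V (structure)
  assumes V: "module K V" and h: "h \<in> linear_maps K A V"
    and rel: "\<And>l r g k. \<lbrakk>(l, r) \<in> R; g \<in> carrier A; k \<in> carrier A\<rbrakk> \<Longrightarrow>
      h (g \<otimes>\<^bsub>A\<^esub> l \<otimes>\<^bsub>A\<^esub> k) = h (g \<otimes>\<^bsub>A\<^esub> r \<otimes>\<^bsub>A\<^esub> k)"
  obtains h' where "h' \<in> linear_maps K (quot_rels A R) V"
    "\<And>a. a \<in> carrier A \<Longrightarrow> h' (quot_class A R a) = h a"
proof -
  interpret V: module K V by (fact V)
  let ?Q = "quot_rels A R" and ?p = "quot_class A R"
  note hD = linear_mapsD[OF h]
  have h_minus: "h (\<ominus>\<^bsub>A\<^esub> x) = \<ominus>\<^bsub>V\<^esub> h x" if "x \<in> carrier A" for x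
  proof -
    have "\<ominus>\<^bsub>A\<^esub> x = (\<ominus> \<one>) \<odot>\<^bsub>A\<^esub> x"
      using that by (simp add: smult_l_minus)
    then show ?thesis
      using that hD(3)[of "\<ominus> \<one>" x] V.smult_l_minus[of \<one> "h x"] hD(1) by simp
  qed
  have h_diff: "h (x \<ominus>\<^bsub>A\<^esub> y) = h x \<ominus>\<^bsub>V\<^esub> h y" if "x \<in> carrier A" "y \<in> carrier A" for x y
    using that hD by (simp add: a_minus_def h_minus)
  have h0: "h \<zero>\<^bsub>A\<^esub> = \<zero>\<^bsub>V\<^esub>"
    by (rule linear_maps_zero[OF h module_axioms V])
  \<comment> \<open>the largest two-sided ideal contained in the kernel of \<open>h\<close>\<close>
  define J where "J = {a \<in> carrier A. \<forall>g\<in>carrier A. \<forall>k\<in>carrier A. h (g \<otimes>\<^bsub>A\<^esub> a \<otimes>\<^bsub>A\<^esub> k) = \<zero>\<^bsub>V\<^esub>}"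
  have "ideal J A"
  proof (rule idealI)
    show "ring A" by (rule A.ring_axioms)
    show "subgroup J (add_monoid A)"
      by (rule M.add.subgroupI)
        (auto simp: J_def h0 A.l_distr A.r_distr A.l_minus A.r_minus h_minus hD intro: M.zero_closed)
  next
    fix a x assume a: "a \<in> J" and x: "x \<in> carrier A"
    have "h (g \<otimes>\<^bsub>A\<^esub> (x \<otimes>\<^bsub>A\<^esub> a) \<otimes>\<^bsub>A\<^esub> k) = h ((g \<otimes>\<^bsub>A\<^esub> x) \<otimes>\<^bsub>A\<^esub> a \<otimes>\<^bsub>A\<^esub> k)"
      "h (g \<otimes>\<^bsub>A\<^esub> (a \<otimes>\<^bsub>A\<^esub> x) \<otimes>\<^bsub>A\<^esub> k) = h (g \<otimes>\<^bsub>A\<^esub> a \<otimes>\<^bsub>A\<^esub> (x \<otimes>\<^bsub>A\<^esub> k))"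
      if "g \<in> carrier A" "k \<in> carrier A" for g k
      using that a x by (simp_all add: J_def A.m_assoc)
    then show "x \<otimes>\<^bsub>A\<^esub> a \<in> J" "a \<otimes>\<^bsub>A\<^esub> x \<in> J"
      using a x by (simp_all add: J_def)
  qed
  moreover have "l \<ominus>\<^bsub>A\<^esub> r \<in> J" if lr: "(l, r) \<in> R" for l r
  proof -
    have c: "l \<in> carrier A" "r \<in> carrier A" using lr rels_carrier by auto
    have "h (g \<otimes>\<^bsub>A\<^esub> (l \<ominus>\<^bsub>A\<^esub> r) \<otimes>\<^bsub>A\<^esub> k) = \<zero>\<^bsub>V\<^esub>" if gk: "g \<in> carrier A" "k \<in> carrier A" for g k
    proof -
      have "g \<otimes>\<^bsub>A\<^esub> (l \<ominus>\<^bsub>A\<^esub> r) \<otimes>\<^bsub>A\<^esub> k = g \<otimes>\<^bsub>A\<^esub> l \<otimes>\<^bsub>A\<^esub> k \<ominus>\<^bsub>A\<^esub> g \<otimes>\<^bsub>A\<^esub> r \<otimes>\<^bsub>A\<^esub> k"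
        using c gk by (simp add: a_minus_def A.l_distr A.r_distr A.l_minus A.r_minus)
      then show ?thesis
        using c gk rel[OF lr gk] hD(1) by (simp add: h_diff) (simp add: a_minus_def V.M.r_neg)
    qed
    then show ?thesis using c by (simp add: J_def)
  qed
  ultimately have J: "rel_ideal A R \<subseteq> J"
    unfolding rel_ideal_def by (intro A.genideal_minimal) auto
  have h_zero: "h a = \<zero>\<^bsub>V\<^esub>" if "a \<in> rel_ideal A R" for a
  proof -
    have "a \<in> carrier A" "h (\<one>\<^bsub>A\<^esub> \<otimes>\<^bsub>A\<^esub> a \<otimes>\<^bsub>A\<^esub> \<one>\<^bsub>A\<^esub>) = \<zero>\<^bsub>V\<^esub>"
      using subsetD[OF J that] A.one_closed unfolding J_def by blast+
    then show ?thesis by simp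
  qed
  have h_eq: "h a = h b" if "a \<in> carrier A" "b \<in> carrier A" "?p a = ?p b" for a b
  proof -
    have "h a \<oplus>\<^bsub>V\<^esub> \<ominus>\<^bsub>V\<^esub> h b = \<zero>\<^bsub>V\<^esub>"
      using h_zero[of "a \<ominus>\<^bsub>A\<^esub> b"] that
      by (simp add: quot_class_eq_iff h_diff a_minus_def[of V])
    then show ?thesis
      using that hD(1) V.M.minus_equality[of "h a" "\<ominus>\<^bsub>V\<^esub> h b"] by simp
  qed
  \<comment> \<open>A representative is chosen in each class; \<open>h_eq\<close> makes the value
    independent of the choice.\<close>
  define h' where "h' = (\<lambda>C. h (SOME a. a \<in> carrier A \<and> ?p a = C))"
  have h': "h' (?p a) = h a" if a: "a \<in> carrier A" for a
  proof -
    have "(SOME b. b \<in> carrier A \<and> ?p b = ?p a) \<in> carrier A \<and>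
        ?p (SOME b. b \<in> carrier A \<and> ?p b = ?p a) = ?p a"
      by (rule someI[where x = a]) (simp add: a)
    then show ?thesis unfolding h'_def by (intro h_eq) (use a in auto)
  qed
  note hom = alg_homD(2-5)[OF quot_class_hom, symmetric]
  have "h' \<in> linear_maps K ?Q V"
    by (auto simp: linear_maps_def carrier_quot_rels hom h' hD)
  then show ?thesis using h' that by blast
qed

end

section \<open>Tensor products\<close>

text \<open>Both sides are linear in \<open>g\<close> and in \<open>k\<close>. This reduces the
  two-sided hypothesis of \<open>quot_rels_lift\<close> to multiplication by basis elements.\<close>

lemma (in monoid_alg) linear_map_sandwich_eq:
  fixes V (structure)
  assumes h: "h \<in> linear_maps K KM V" and l: "l \<in> carrier KM" and r: "r \<in> carrier KM"
    and basis: "\<And>a b. \<lbrakk>a \<in> carrier M; b \<in> carrier M\<rbrakk> \<Longrightarrow>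
      h (bas a \<otimes>\<^bsub>KM\<^esub> l \<otimes>\<^bsub>KM\<^esub> bas b) = h (bas a \<otimes>\<^bsub>KM\<^esub> r \<otimes>\<^bsub>KM\<^esub> bas b)"
    and g: "g \<in> carrier KM" and k: "k \<in> carrier KM"
  shows "h (g \<otimes>\<^bsub>KM\<^esub> l \<otimes>\<^bsub>KM\<^esub> k) = h (g \<otimes>\<^bsub>KM\<^esub> r \<otimes>\<^bsub>KM\<^esub> k)"
proof -
  note h_linear = linear_mapsD(2,3)[OF h, unfolded monoid_algebra_simps]
  show ?thesis
    using g
  proof (induction g rule: KM_induct)
    case (basis a)
    show ?case
      using k
      by (induction k rule: KM_induct) (simp_all add: mult_linear h_linear l r basis assms(4))
  qed (simp_all add: mult_linear h_linear l r k)
qed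

locale tensor_product = A: assoc_algebra K A + B: assoc_algebra K B
  for K (structure) and A (structure) and B (structure)
begin

abbreviation "AB \<equiv> monoid_algebra K (A \<times>\<times> B)"
abbreviation "T \<equiv> tensor_algebra K A B"
abbreviation "t \<equiv> pure_tensor K A B"

sublocale F: monoid_alg K "A \<times>\<times> B"
  by (intro monoid_alg.intro A.R.is_cring DirProd_monoid A.A.is_monoid B.A.is_monoid)

lemma bilinear_rels_carrier: "bilinear_rels K A B \<subseteq> carrier AB \<times> carrier AB"
  by (auto simp: bilinear_rels_def)

sublocale F: presented_algebra K AB "bilinear_rels K A B"
  by (intro presented_algebra.intro presented_algebra_axioms.intro F.monoid_algebra_assoc
      bilinear_rels_carrier)

lemma tensor_algebra_assoc: "assoc_algebra K T"
  unfolding tensor_algebra_def by (rule F.quot_rels_assoc)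

lemma t_hom: "quot_class AB (bilinear_rels K A B) \<in> alg_hom K AB T"
  unfolding tensor_algebra_def by (rule F.quot_class_hom)

lemma t_closed [simp]: "\<lbrakk>a \<in> carrier A; b \<in> carrier B\<rbrakk> \<Longrightarrow> t a b \<in> carrier T"
  unfolding pure_tensor_def by (rule alg_homD(1)[OF t_hom]) simp

lemma t_mult:
  assumes "a \<in> carrier A" "a' \<in> carrier A" "b \<in> carrier B" "b' \<in> carrier B"
  shows "t a b \<otimes>\<^bsub>T\<^esub> t a' b' = t (a \<otimes>\<^bsub>A\<^esub> a') (b \<otimes>\<^bsub>B\<^esub> b')"
  using assms alg_homD(4)[OF t_hom, of "basis_elem K (a, b)" "basis_elem K (a', b')"]
  by (simp add: pure_tensor_def F.mult_basis)

lemma t_one: "\<one>\<^bsub>T\<^esub> = t \<one>\<^bsub>A\<^esub> \<one>\<^bsub>B\<^esub>"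
  using alg_homD(5)[OF t_hom] by (simp add: pure_tensor_def)

lemma t_add_l:
  assumes "a \<in> carrier A" "a' \<in> carrier A" "b \<in> carrier B"
  shows "t (a \<oplus>\<^bsub>A\<^esub> a') b = t a b \<oplus>\<^bsub>T\<^esub> t a' b"
proof -
  have "t (a \<oplus>\<^bsub>A\<^esub> a') b = quot_class AB (bilinear_rels K A B)
      (basis_elem K (a, b) \<oplus>\<^bsub>AB\<^esub> basis_elem K (a', b))"
    unfolding pure_tensor_def
    by (rule F.quot_class_rel) (unfold bilinear_rels_def Let_def, use assms in blast)
  then show ?thesis
    using assms by (simp add: alg_homD(2)[OF t_hom] pure_tensor_def del: monoid_algebra_simps)
qed

lemma t_add_r:
  assumes "a \<in> carrier A" "b \<in> carrier B" "b' \<in> carrier B"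
  shows "t a (b \<oplus>\<^bsub>B\<^esub> b') = t a b \<oplus>\<^bsub>T\<^esub> t a b'"
proof -
  have "t a (b \<oplus>\<^bsub>B\<^esub> b') = quot_class AB (bilinear_rels K A B)
      (basis_elem K (a, b) \<oplus>\<^bsub>AB\<^esub> basis_elem K (a, b'))"
    unfolding pure_tensor_def
    by (rule F.quot_class_rel) (unfold bilinear_rels_def Let_def, use assms in blast)
  then show ?thesis
    using assms by (simp add: alg_homD(2)[OF t_hom] pure_tensor_def del: monoid_algebra_simps)
qed

lemma t_smult_l:
  assumes "c \<in> carrier K" "a \<in> carrier A" "b \<in> carrier B"
  shows "t (c \<odot>\<^bsub>A\<^esub> a) b = c \<odot>\<^bsub>T\<^esub> t a b"
proof -
  have "t (c \<odot>\<^bsub>A\<^esub> a) b = quot_class AB (bilinear_rels K A B) (c \<odot>\<^bsub>AB\<^esub> basis_elem K (a, b))"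
    unfolding pure_tensor_def
    by (rule F.quot_class_rel) (unfold bilinear_rels_def Let_def, use assms in blast)
  then show ?thesis
    using assms by (simp add: alg_homD(3)[OF t_hom] pure_tensor_def del: monoid_algebra_simps)
qed

lemma t_smult_r:
  assumes "c \<in> carrier K" "a \<in> carrier A" "b \<in> carrier B"
  shows "t a (c \<odot>\<^bsub>B\<^esub> b) = c \<odot>\<^bsub>T\<^esub> t a b"
proof -
  have "t a (c \<odot>\<^bsub>B\<^esub> b) = quot_class AB (bilinear_rels K A B) (c \<odot>\<^bsub>AB\<^esub> basis_elem K (a, b))"
    unfolding pure_tensor_def
    by (rule F.quot_class_rel) (unfold bilinear_rels_def Let_def, use assms in blast)
  then show ?thesis
    using assms by (simp add: alg_homD(3)[OF t_hom] pure_tensor_def del: monoid_algebra_simps)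
qed

lemmas t_bilinear = t_add_l t_add_r t_smult_l t_smult_r

text \<open>Pure tensors span: they are the images of the basis pairs under the surjective linear
  quotient map.\<close>

lemma tensor_induct [consumes 1, case_names pure smult add]:
  assumes "w \<in> carrier T"
    and "\<And>a b. \<lbrakk>a \<in> carrier A; b \<in> carrier B\<rbrakk> \<Longrightarrow> P (t a b)"
    and "\<And>c v. \<lbrakk>c \<in> carrier K; v \<in> carrier T; P v\<rbrakk> \<Longrightarrow> P (c \<odot>\<^bsub>T\<^esub> v)"
    and "\<And>v w. \<lbrakk>v \<in> carrier T; w \<in> carrier T; P v; P w\<rbrakk> \<Longrightarrow> P (v \<oplus>\<^bsub>T\<^esub> w)"
  shows "P w"
proof -
  let ?p = "quot_class AB (bilinear_rels K A B)"
  note p_linear = alg_homD(2,3)[OF t_hom, unfolded monoid_algebra_simps]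
  obtain f where f: "f \<in> carrier AB" "w = ?p f"
    using assms(1) by (auto simp: tensor_algebra_def F.carrier_quot_rels)
  have "P (?p f)"
    using f(1)
    by (induction f rule: F.KM_induct)
      (use assms(2-4) alg_homD(1)[OF t_hom] in \<open>auto simp: p_linear pure_tensor_def\<close>)
  then show ?thesis by (simp add: f)
qed

text \<open>The universal property for bilinear maps, with values in a mere module. Although the
  tensor product is built as a quotient by a two-sided ideal, \<open>\<phi>\<close> need not respect
  products, because that ideal is already the linear span of the bilinearity relations.\<close>

lemma tensor_lift:
  fixes V (structure)
  assumes V: "module K V"
    and closed: "\<And>a b. \<lbrakk>a \<in> carrier A; b \<in> carrier B\<rbrakk> \<Longrightarrow> \<phi> a b \<in> carrier V"
    and add_l: "\<And>a a' b. \<lbrakk>a \<in> carrier A; a' \<in> carrier A; b \<in> carrier B\<rbrakk> \<Longrightarrow>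
      \<phi> (a \<oplus>\<^bsub>A\<^esub> a') b = \<phi> a b \<oplus>\<^bsub>V\<^esub> \<phi> a' b"
    and add_r: "\<And>a b b'. \<lbrakk>a \<in> carrier A; b \<in> carrier B; b' \<in> carrier B\<rbrakk> \<Longrightarrow>
      \<phi> a (b \<oplus>\<^bsub>B\<^esub> b') = \<phi> a b \<oplus>\<^bsub>V\<^esub> \<phi> a b'"
    and smult_l: "\<And>c a b. \<lbrakk>c \<in> carrier K; a \<in> carrier A; b \<in> carrier B\<rbrakk> \<Longrightarrow>
      \<phi> (c \<odot>\<^bsub>A\<^esub> a) b = c \<odot>\<^bsub>V\<^esub> \<phi> a b"
    and smult_r: "\<And>c a b. \<lbrakk>c \<in> carrier K; a \<in> carrier A; b \<in> carrier B\<rbrakk> \<Longrightarrow>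
      \<phi> a (c \<odot>\<^bsub>B\<^esub> b) = c \<odot>\<^bsub>V\<^esub> \<phi> a b"
  obtains h where "h \<in> linear_maps K T V"
    "\<And>a b. \<lbrakk>a \<in> carrier A; b \<in> carrier B\<rbrakk> \<Longrightarrow> h (t a b) = \<phi> a b"
proof -
  let ?p = "\<lambda>a b. basis_elem K (a, b)"
  obtain g where g: "g \<in> linear_maps K AB V"
    and g_basis: "\<And>x. x \<in> carrier (A \<times>\<times> B) \<Longrightarrow> g (basis_elem K x) = (case x of (a, b) \<Rightarrow> \<phi> a b)"
    by (rule F.linear_extension[OF V, of "\<lambda>(a, b). \<phi> a b"]) (use closed in auto)
  have g_p: "g (?p a b) = \<phi> a b" if "a \<in> carrier A" "b \<in> carrier B" for a b
    using g_basis[of "(a, b)"] that by simp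
  note g_linear = linear_mapsD(2,3)[OF g, unfolded monoid_algebra_simps]
  \<comment> \<open>Multiplying a bilinearity relation on both sides by basis pairs gives a
    bilinearity relation of the same kind, with the entries replaced by products; the assumptions on
    \<open>\<phi>\<close> then apply.\<close>
  have rel: "g (f \<otimes>\<^bsub>AB\<^esub> l \<otimes>\<^bsub>AB\<^esub> k) = g (f \<otimes>\<^bsub>AB\<^esub> r \<otimes>\<^bsub>AB\<^esub> k)"
    if lr: "(l, r) \<in> bilinear_rels K A B" and f: "f \<in> carrier AB" and k: "k \<in> carrier AB"
    for l r f k
  proof (rule F.linear_map_sandwich_eq[OF g _ _ _ f k])
    show lr_carrier: "l \<in> carrier AB" "r \<in> carrier AB"
      using lr bilinear_rels_carrier by auto
    fix x y assume "x \<in> carrier (A \<times>\<times> B)" "y \<in> carrier (A \<times>\<times> B)"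
    then obtain a b a' b' where xy: "x = (a, b)" "y = (a', b')"
      and [simp]: "a \<in> carrier A" "b \<in> carrier B" "a' \<in> carrier A" "b' \<in> carrier B"
      by auto
    show "g (basis_elem K x \<otimes>\<^bsub>AB\<^esub> l \<otimes>\<^bsub>AB\<^esub> basis_elem K y) =
        g (basis_elem K x \<otimes>\<^bsub>AB\<^esub> r \<otimes>\<^bsub>AB\<^esub> basis_elem K y)"
      using lr unfolding bilinear_rels_def Let_def xy
      by (auto simp: F.mult_basis F.mult_linear g_p g_linear A.A.l_distr A.A.r_distr
          B.A.l_distr B.A.r_distr add_l add_r smult_l smult_r A.smult_mult_l A.smult_mult_r
          B.smult_mult_l B.smult_mult_r)
  qed
  obtain h where h: "h \<in> linear_maps K (quot_rels AB (bilinear_rels K A B)) V"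
    and h_class: "\<And>f. f \<in> carrier AB \<Longrightarrow> h (quot_class AB (bilinear_rels K A B) f) = g f"
    by (rule F.quot_rels_lift[OF V g rel]) blast+
  show ?thesis
  proof
    show "h \<in> linear_maps K T V" using h by (simp add: tensor_algebra_def)
    show "h (t a b) = \<phi> a b" if "a \<in> carrier A" "b \<in> carrier B" for a b
      using that by (simp add: pure_tensor_def h_class g_p)
  qed
qed

end

section \<open>Algebras given by generators and relations\<close>

lemma word_monoid_simps [simp]:
  "carrier (word_monoid S) = lists S" "u \<otimes>\<^bsub>word_monoid S\<^esub> v = u @ v" "\<one>\<^bsub>word_monoid S\<^esub> = []"
  by (simp_all add: word_monoid_def)

lemma monoid_word_monoid: "Group.monoid (word_monoid S)"
  by (rule monoidI) auto

text \<open>The class of a monomial. On a one-letter word it is the class of the corresponding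
  \<open>free_gen\<close>, that is, a generator of the presented algebra.\<close>

definition word_class ::
    "('k, 'e) ring_scheme \<Rightarrow> 's set \<Rightarrow> (('s list \<Rightarrow> 'k) \<times> ('s list \<Rightarrow> 'k)) set \<Rightarrow> 's list \<Rightarrow> ('s list \<Rightarrow> 'k) set"
  where "word_class K S R w = quot_class (free_algebra K S) R (basis_elem K w)"

text \<open>The common setting of both quantum affine spaces and of quantum matrices, so that the
  calculus of words is developed once.\<close>

locale free_presentation = R?: cring K for K (structure) +
  fixes S :: "'s set" and R :: "(('s list \<Rightarrow> 'a) \<times> ('s list \<Rightarrow> 'a)) set"
  assumes rels_subset: "R \<subseteq> carrier (free_algebra K S) \<times> carrier (free_algebra K S)"
begin

abbreviation "Q \<equiv> quot_rels (free_algebra K S) R"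
abbreviation "W \<equiv> word_class K S R"

sublocale F: monoid_alg K "word_monoid S"
  by (intro monoid_alg.intro monoid_word_monoid R.is_cring)

sublocale F: presented_algebra K "free_algebra K S" R
  by (intro presented_algebra.intro presented_algebra_axioms.intro rels_subset)
    (simp add: free_algebra_def F.monoid_algebra_assoc)

lemma W_closed [simp]: "w \<in> lists S \<Longrightarrow> W w \<in> carrier Q"
  unfolding word_class_def by (rule alg_homD(1)[OF F.quot_class_hom]) (simp add: free_algebra_def)

lemma W_Nil: "W [] = \<one>\<^bsub>Q\<^esub>"
  using alg_homD(5)[OF F.quot_class_hom] by (simp add: word_class_def free_algebra_def)

lemma W_append:
  assumes "u \<in> lists S" "v \<in> lists S"
  shows "W (u @ v) = W u \<otimes>\<^bsub>Q\<^esub> W v"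
  using assms alg_homD(4)[OF F.quot_class_hom, of "basis_elem K u" "basis_elem K v"]
  by (simp add: word_class_def free_algebra_def F.mult_basis)

lemma W_Cons:
  assumes "s \<in> S" "w \<in> lists S"
  shows "W (s # w) = W [s] \<otimes>\<^bsub>Q\<^esub> W w"
  using W_append[of "[s]" w] assms by simp

text \<open>Words span the quotient because they span the free algebra; their linear independence is
  not claimed.\<close>

lemma word_induct [consumes 1, case_names word smult add]:
  assumes "x \<in> carrier Q"
    and "\<And>w. w \<in> lists S \<Longrightarrow> P (W w)"
    and "\<And>c x. \<lbrakk>c \<in> carrier K; x \<in> carrier Q; P x\<rbrakk> \<Longrightarrow> P (c \<odot>\<^bsub>Q\<^esub> x)"
    and "\<And>x y. \<lbrakk>x \<in> carrier Q; y \<in> carrier Q; P x; P y\<rbrakk> \<Longrightarrow> P (x \<oplus>\<^bsub>Q\<^esub> y)"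
  shows "P x"
proof -
  let ?p = "quot_class (free_algebra K S) R"
  note hom = F.quot_class_hom
  note p_linear = alg_homD(2,3)[OF hom, unfolded free_algebra_def monoid_algebra_simps]
  obtain f where f: "f \<in> carrier (free_algebra K S)" "x = ?p f"
    using assms(1) by (auto simp: F.carrier_quot_rels)
  have "P (?p f)"
    using f(1) unfolding free_algebra_def
    by (induction f rule: F.KM_induct)
      (use assms(2-4) alg_homD(1)[OF hom] in
        \<open>auto simp: p_linear word_class_def free_algebra_def\<close>)
  then show ?thesis by (simp add: f)
qed

end

lemma free_gen_closed:
  assumes "cring K" "s \<in> S"
  shows "free_gen K s \<in> carrier (free_algebra K S)"
proof -
  interpret monoid_alg K "word_monoid S"
    by (intro monoid_alg.intro monoid_word_monoid assms)
  show ?thesis using assms by (simp add: free_gen_def free_algebra_def)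
qed

lemma free_algebra_assoc:
  assumes "cring K"
  shows "assoc_algebra K (free_algebra K S)"
proof -
  interpret monoid_alg K "word_monoid S"
    by (intro monoid_alg.intro monoid_word_monoid assms)
  show ?thesis unfolding free_algebra_def by (rule monoid_algebra_assoc)
qed

lemma free_presentation_qaffine:
  assumes "cring K" "q \<in> carrier K"
  shows "free_presentation K {1..n} (qaffine_rels K q n)"
proof -
  interpret F: assoc_algebra K "free_algebra K {1..n}"
    by (rule free_algebra_assoc[OF assms(1)])
  show ?thesis
    using assms free_gen_closed[OF assms(1), of _ "{1..n}"]
    by (auto simp: free_presentation_def free_presentation_axioms_def qaffine_rels_def Let_def
        simp del: One_nat_def)
qed

lemma free_presentation_qmatrix:
  assumes "field K" "q \<in> carrier K - {\<zero>\<^bsub>K\<^esub>}"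
  shows "free_presentation K ({1..m} \<times> {1..n}) (qmatrix_rels K q m n)"
proof -
  interpret K: field K by (rule assms(1))
  interpret F: assoc_algebra K "free_algebra K ({1..m} \<times> {1..n})"
    by (rule free_algebra_assoc[OF K.is_cring])
  \<comment> \<open>A nonzero element of a field is a unit, so the coefficient in the last family of
    relations is a genuine scalar.\<close>
  have "inv\<^bsub>K\<^esub> q \<in> carrier K"
    using assms K.field_Units by (intro K.Units_inv_closed) simp
  then have "q \<ominus>\<^bsub>K\<^esub> inv\<^bsub>K\<^esub> q \<in> carrier K"
    using assms by simp
  then show ?thesis
    using assms K.is_cring free_gen_closed[OF K.is_cring, of _ "{1..m} \<times> {1..n}"]
    by (auto simp: free_presentation_def free_presentation_axioms_def qmatrix_rels_def Let_def
        simp del: One_nat_def)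
qed

section \<open>Coinvariants\<close>

text \<open>The maps \<open>\<theta>\<close> and \<open>\<gamma>\<close> are arbitrary algebra
  homomorphisms with the prescribed values on generators. This determines them on the carriers;
  elsewhere their values are unconstrained.\<close>

theorem theorem2p4:
  fixes K :: "('k, 'e) ring_scheme" and q :: 'k and m n :: nat
    and \<theta> :: "((nat \<times> nat) list \<Rightarrow> 'k) set \<Rightarrow>
      ((nat list \<Rightarrow> 'k) set \<times> (nat list \<Rightarrow> 'k) set \<Rightarrow> 'k) set"
    and \<gamma> :: "((nat list \<Rightarrow> 'k) set \<times> (nat list \<Rightarrow> 'k) set \<Rightarrow> 'k) set \<Rightarrow>
      ((int \<Rightarrow> 'k) \<times> ((nat list \<Rightarrow> 'k) set \<times> (nat list \<Rightarrow> 'k) set \<Rightarrow> 'k) set \<Rightarrow> 'k) set"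
  defines "A \<equiv> qaffine K q m" and "B \<equiv> qaffine K q n"
  defines "T \<equiv> tensor_algebra K A B" and "L \<equiv> laurent_algebra K"
  defines "y \<equiv> qaffine_gen K q m" and "z \<equiv> qaffine_gen K q n"
  assumes "field K" and "q \<in> carrier K - {\<zero>\<^bsub>K\<^esub>}" and "m \<ge> 1" and "n \<ge> 1"
    and "\<theta> \<in> alg_hom K (qmatrix K q m n) T"
    and "\<And>i j. i \<in> {1..m} \<Longrightarrow> j \<in> {1..n} \<Longrightarrow>
      \<theta> (qmatrix_gen K q m n i j) = pure_tensor K A B (y i) (z j)"
    and "\<gamma> \<in> alg_hom K T (tensor_algebra K L T)"
    and "\<And>i. i \<in> {1..m} \<Longrightarrow> \<gamma> (pure_tensor K A B (y i) \<one>\<^bsub>B\<^esub>) =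
      pure_tensor K L T (laurent_x_inv K) (pure_tensor K A B (y i) \<one>\<^bsub>B\<^esub>)"
    and "\<And>j. j \<in> {1..n} \<Longrightarrow> \<gamma> (pure_tensor K A B \<one>\<^bsub>A\<^esub> (z j)) =
      pure_tensor K L T (laurent_x K) (pure_tensor K A B \<one>\<^bsub>A\<^esub> (z j))"
  shows "{w \<in> carrier T. \<gamma> w = pure_tensor K L T \<one>\<^bsub>L\<^esub> w} = \<theta> ` carrier (qmatrix K q m n)"
proof -
  interpret K: field K by fact
  let ?M = "qmatrix K q m n"
  define Y where "Y = word_class K {1..m} (qaffine_rels K q m)"
  define Z where "Z = word_class K {1..n} (qaffine_rels K q n)"
  define X where "X = word_class K ({1..m} \<times> {1..n}) (qmatrix_rels K q m n)"
  define t where "t = pure_tensor K A B"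
  define t' where "t' = pure_tensor K L T"
  \<comment> \<open>\<open>x d\<close> is the Laurent monomial of degree \<open>d\<close>; in
    particular \<open>x 1\<close> is \<open>laurent_x K\<close> and \<open>x (- 1)\<close> is
    \<open>laurent_x_inv K\<close>.\<close>
  define x where "x = (basis_elem K :: int \<Rightarrow> int \<Rightarrow> 'k)"
  have q: "q \<in> carrier K" using assms(8) by simp
  interpret A: free_presentation K "{1..m}" "qaffine_rels K q m"
    rewrites "quot_rels (free_algebra K {1..m}) (qaffine_rels K q m) \<equiv> A"
      and "word_class K {1..m} (qaffine_rels K q m) \<equiv> Y"
    by (rule free_presentation_qaffine[OF K.is_cring q])
      (simp_all add: A_def qaffine_def Y_def)
  interpret B: free_presentation K "{1..n}" "qaffine_rels K q n"
    rewrites "quot_rels (free_algebra K {1..n}) (qaffine_rels K q n) \<equiv> B"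
      and "word_class K {1..n} (qaffine_rels K q n) \<equiv> Z"
    by (rule free_presentation_qaffine[OF K.is_cring q])
      (simp_all add: B_def qaffine_def Z_def)
  interpret M: free_presentation K "{1..m} \<times> {1..n}" "qmatrix_rels K q m n"
    rewrites "quot_rels (free_algebra K ({1..m} \<times> {1..n})) (qmatrix_rels K q m n) \<equiv> ?M"
      and "word_class K ({1..m} \<times> {1..n}) (qmatrix_rels K q m n) \<equiv> X"
    by (rule free_presentation_qmatrix[OF assms(7,8)]) (simp_all add: qmatrix_def X_def)
  interpret T: tensor_product K A B
    rewrites "tensor_algebra K A B \<equiv> T" and "pure_tensor K A B \<equiv> t"
    by (intro tensor_product.intro A.F.quot_rels_assoc B.F.quot_rels_assoc)
      (simp_all add: T_def t_def)
  interpret L: monoid_alg K integer_group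
    rewrites "monoid_algebra K integer_group \<equiv> L" and "basis_elem K \<equiv> x"
    by (intro monoid_alg.intro K.is_cring group.is_monoid group_integer_group)
      (simp_all add: L_def laurent_algebra_def x_def)
  interpret L: assoc_algebra K L by (rule L.monoid_algebra_assoc)
  interpret TA: assoc_algebra K T by (rule T.tensor_algebra_assoc)
  interpret M: assoc_algebra K ?M by (rule M.F.quot_rels_assoc)
  interpret LT: tensor_product K L T
    rewrites "pure_tensor K L T \<equiv> t'"
    by (intro tensor_product.intro L.assoc_algebra_axioms TA.assoc_algebra_axioms)
      (simp_all add: t'_def)
  note \<theta> = alg_homD[OF assms(11)] and \<gamma> = alg_homD[OF assms(13)]
  have gens: "y i = Y [i]" "z j = Z [j]" "qmatrix_gen K q m n i j = X [(i, j)]" for i j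
    by (simp_all add: y_def z_def qaffine_gen_def qmatrix_gen_def Y_def Z_def X_def word_class_def
        free_gen_def)
  have ones: "\<one>\<^bsub>A\<^esub> = Y []" "\<one>\<^bsub>B\<^esub> = Z []" "\<one>\<^bsub>T\<^esub> = t (Y []) (Z [])" "\<one>\<^bsub>?M\<^esub> = X []"
    using A.W_Nil B.W_Nil T.t_one M.W_Nil by simp_all
  have L_one: "\<one>\<^bsub>L\<^esub> = x 0"
    by (simp add: L_def laurent_algebra_def x_def)
  have x_closed [simp]: "x d \<in> carrier L" for d
    using L.basis_closed[of d] by simp
  have x_mult: "x d \<otimes>\<^bsub>L\<^esub> x e = x (d + e)" for d e
    using L.mult_basis[of d e] by simp
  have \<theta>_gen: "\<theta> (X [(i, j)]) = t (Y [i]) (Z [j])" if "i \<in> {1..m}" "j \<in> {1..n}" for i j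
    using assms(12)[OF that] by (simp add: gens t_def)
  have \<gamma>_y: "\<gamma> (t (Y [i]) (Z [])) = t' (x (- 1)) (t (Y [i]) (Z []))" if "i \<in> {1..m}" for i
    using assms(14)[OF that] by (simp add: gens ones t_def t'_def x_def laurent_x_inv_def)
  have \<gamma>_z: "\<gamma> (t (Y []) (Z [j])) = t' (x 1) (t (Y []) (Z [j]))" if "j \<in> {1..n}" for j
    using assms(15)[OF that] by (simp add: gens ones t_def t'_def x_def laurent_x_def)

  \<comment> \<open>The values of \<open>\<gamma>\<close> and \<open>\<theta>\<close> on
    words\<close>
  have t_words: "t (Y u) (Z v) \<otimes>\<^bsub>T\<^esub> t (Y u') (Z v') = t (Y (u @ u')) (Z (v @ v'))"
    if "u \<in> lists {1..m}" "u' \<in> lists {1..m}" "v \<in> lists {1..n}" "v' \<in> lists {1..n}" for u u' v v'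
    using that by (simp add: T.t_mult A.W_append B.W_append)
  have \<gamma>_Nil: "\<gamma> (t (Y []) (Z [])) = t' (x 0) (t (Y []) (Z []))"
    using \<gamma>(5) LT.t_one by (simp add: ones L_one)
  \<comment> \<open>Call \<open>a\<close> homogeneous of degree \<open>d\<close> when
    \<open>\<gamma> a = t' (x d) a\<close>. Since \<open>\<gamma>\<close> is multiplicative and
    exponents of Laurent monomials add, degrees add under products.\<close>
  have \<gamma>_mult: "\<gamma> (a \<otimes>\<^bsub>T\<^esub> b) = t' (x (d + e)) (a \<otimes>\<^bsub>T\<^esub> b)"
    if "\<gamma> a = t' (x d) a" "\<gamma> b = t' (x e) b" "a \<in> carrier T" "b \<in> carrier T" for a b d e
    using that by (simp add: \<gamma>(4) LT.t_mult x_mult)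
  have \<gamma>_Y: "\<gamma> (t (Y u) (Z [])) = t' (x (- int (length u))) (t (Y u) (Z []))"
    if "u \<in> lists {1..m}" for u
    using that
  proof (induction u)
    case Nil
    then show ?case using \<gamma>_Nil by simp
  next
    case (Cons i u)
    then show ?case
      using \<gamma>_mult[OF \<gamma>_y[of i] Cons.IH] t_words[of "[i]" u "[]" "[]"] by simp
  qed
  have \<gamma>_Z: "\<gamma> (t (Y []) (Z v)) = t' (x (int (length v))) (t (Y []) (Z v))"
    if "v \<in> lists {1..n}" for v
    using that
  proof (induction v)
    case Nil
    then show ?case using \<gamma>_Nil by simp
  next
    case (Cons j v)
    then show ?case
      using \<gamma>_mult[OF \<gamma>_z[of j] Cons.IH] t_words[of "[]" "[]" "[j]" v] by simp
  qed
  \<comment> \<open>The tensor of \<open>u\<close> and \<open>v\<close> is the product of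
    \<open>u \<otimes> 1\<close>, of degree minus the length of \<open>u\<close>, and
    \<open>1 \<otimes> v\<close>, of degree the length of \<open>v\<close>.\<close>
  have \<gamma>_words: "\<gamma> (t (Y u) (Z v)) = t' (x (int (length v) - int (length u))) (t (Y u) (Z v))"
    if "u \<in> lists {1..m}" "v \<in> lists {1..n}" for u v
    using \<gamma>_mult[OF \<gamma>_Y[of u] \<gamma>_Z[of v]] t_words[of u "[]" "[]" v] that by simp
  \<comment> \<open>Letters are paired in order. In the tensor product the two factors multiply
    independently, so the product of the \<open>t (Y [i]) (Z [j])\<close> separates into the whole
    word \<open>u\<close> and the whole word \<open>v\<close>.\<close>
  have \<theta>_zip: "\<theta> (X (zip u v)) = t (Y u) (Z v)"
    if "length u = length v" "u \<in> lists {1..m}" "v \<in> lists {1..n}" for u v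
    using that
  proof (induction u v rule: list_induct2)
    case Nil
    then show ?case using \<theta>(5) by (simp add: ones)
  next
    case (Cons i u j v)
    then have w: "zip u v \<in> lists ({1..m} \<times> {1..n})"
      by (auto dest: set_zip_leftD set_zip_rightD)
    then show ?case
      using Cons M.W_Cons[of "(i, j)" "zip u v"] t_words[of "[i]" u "[j]" v]
      by (simp add: \<theta>(4) \<theta>_gen)
  qed

  \<comment> \<open>The image of \<open>\<theta>\<close> consists of coinvariants\<close>
  have coinv: "\<gamma> (\<theta> w) = t' \<one>\<^bsub>L\<^esub> (\<theta> w)" if "w \<in> carrier ?M" for w
    using that
  proof (induction w rule: M.word_induct)
    case (word w)
    then show ?case
    proof (induction w)
      case Nil
      show ?case using \<gamma>_Nil \<theta>(5) by (simp add: ones L_one)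
    next
      case (Cons p w)
      then obtain i j where p: "p = (i, j)" "i \<in> {1..m}" "j \<in> {1..n}" by auto
      \<comment> \<open>The image of a generator has one letter on each side, hence degree 0;
        products then keep degree 0.\<close>
      then have "\<gamma> (\<theta> (X [p])) = t' (x 0) (\<theta> (X [p]))"
        using \<gamma>_words[of "[i]" "[j]"] \<theta>_gen by simp
      then show ?case
        using Cons p \<gamma>_mult[of "\<theta> (X [p])" 0 "\<theta> (X w)" 0] M.W_Cons[of p w] \<theta>(1,4)
        by (simp add: L_one)
    qed
  next
    case (smult c w)
    then show ?case by (simp add: \<theta> \<gamma> LT.t_bilinear)
  next
    case (add v w)
    then show ?case by (simp add: \<theta> \<gamma> LT.t_bilinear)
  qed

  \<comment> \<open>The constant-coefficient projection and the reverse inclusion\<close>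
  have coeff_add: "(f \<oplus>\<^bsub>L\<^esub> g) 0 = f 0 \<oplus>\<^bsub>K\<^esub> g 0" and coeff_smult: "(c \<odot>\<^bsub>L\<^esub> f) 0 = c \<otimes>\<^bsub>K\<^esub> f 0" for f g c
    by (simp_all add: L_def laurent_algebra_def)
  note coeff_closed = L.coeff_closed[where x = 0]
  \<comment> \<open>Bilinearity in the second argument uses commutativity of \<open>K\<close>, to
    move a scalar past \<open>f 0\<close>.\<close>
  obtain \<pi> where \<pi>: "\<pi> \<in> linear_maps K (tensor_algebra K L T) T"
    and \<pi>_t': "\<And>f w. \<lbrakk>f \<in> carrier L; w \<in> carrier T\<rbrakk> \<Longrightarrow> \<pi> (t' f w) = f 0 \<odot>\<^bsub>T\<^esub> w"
    by (rule LT.tensor_lift[OF TA.module_axioms, of "\<lambda>f w. f 0 \<odot>\<^bsub>T\<^esub> w"])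
      (simp_all add: coeff_closed coeff_add coeff_smult TA.smult_l_distr TA.smult_r_distr
        TA.smult_assoc1[symmetric] K.m_comm)
  note \<pi>_linear = linear_mapsD[OF \<pi>]
  have image_words: "\<pi> (\<gamma> (t (Y u) (Z v))) \<in> \<theta> ` carrier ?M"
    if u: "u \<in> lists {1..m}" and v: "v \<in> lists {1..n}" for u v
  proof -
    \<comment> \<open>The scalar is the coefficient at 0 of the monomial whose degree is the
      difference of the two lengths.\<close>
    have eq: "\<pi> (\<gamma> (t (Y u) (Z v))) =
        (if length u = length v then \<one>\<^bsub>K\<^esub> else \<zero>\<^bsub>K\<^esub>) \<odot>\<^bsub>T\<^esub> t (Y u) (Z v)"
      using u v by (simp add: \<gamma>_words \<pi>_t') (simp add: x_def basis_elem_def)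
    show ?thesis
    proof (cases "length u = length v")
      case True
      have "zip u v \<in> lists ({1..m} \<times> {1..n})"
        using u v by (auto dest: set_zip_leftD set_zip_rightD)
      then have "\<theta> (X (zip u v)) \<in> \<theta> ` carrier ?M" by simp
      then show ?thesis using eq True \<theta>_zip u v by simp
    next
      case False
      \<comment> \<open>Words of different lengths are sent to zero, which is exhibited as a value
        of \<open>\<theta>\<close>, namely at the zero multiple of the unit
        \<open>X []\<close>.\<close>
      have "\<pi> (\<gamma> (t (Y u) (Z v))) = \<theta> (\<zero>\<^bsub>K\<^esub> \<odot>\<^bsub>?M\<^esub> X [])"
        using eq False u v \<theta>(1)[of "X []"] by (subst \<theta>(3)) simp_all
      then show ?thesis by (metis M.W_closed M.smult_closed K.zero_closed imageI lists.Nil)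
    qed
  qed
  have image_smult: "c \<odot>\<^bsub>T\<^esub> w \<in> \<theta> ` carrier ?M" if "c \<in> carrier K" "w \<in> \<theta> ` carrier ?M" for c w
    using that by (auto simp: \<theta>(3)[symmetric])
  have image_add: "v \<oplus>\<^bsub>T\<^esub> w \<in> \<theta> ` carrier ?M" if "v \<in> \<theta> ` carrier ?M" "w \<in> \<theta> ` carrier ?M" for v w
    using that by (auto simp: \<theta>(2)[symmetric])
  \<comment> \<open>The composite of \<open>\<pi>\<close> and \<open>\<gamma>\<close> is linear and
    the image of \<open>\<theta>\<close> is a subspace, so it is enough to treat pure tensors, and
    then, expanding each factor in turn, tensors of words.\<close>
  have image: "\<pi> (\<gamma> w) \<in> \<theta> ` carrier ?M" if "w \<in> carrier T" for w
    using that
  proof (induction w rule: T.tensor_induct)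
    case (pure a b)
    from pure(1) show ?case
    proof (induction a rule: A.word_induct)
      case (word u)
      from pure(2) show ?case
        by (induction b rule: B.word_induct)
          (simp_all add: word image_words T.t_bilinear \<gamma> \<pi>_linear image_smult image_add
              del: One_nat_def)
    qed (simp_all add: pure T.t_bilinear \<gamma> \<pi>_linear image_smult image_add)
  qed (simp_all add: \<gamma> \<pi>_linear image_smult image_add)
  have "{w \<in> carrier T. \<gamma> w = t' \<one>\<^bsub>L\<^esub> w} = \<theta> ` carrier ?M"
  proof (intro equalityI subsetI)
    fix w assume "w \<in> {w \<in> carrier T. \<gamma> w = t' \<one>\<^bsub>L\<^esub> w}"
    then have w: "w \<in> carrier T" "\<gamma> w = t' (x 0) w" by (simp_all add: L_one)
    then have "\<pi> (\<gamma> w) = w"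
      by (simp add: \<pi>_t') (simp add: x_def basis_elem_def)
    then show "w \<in> \<theta> ` carrier ?M" using image[OF w(1)] by simp
  qed (auto simp: coinv \<theta>(1))
  then show ?thesis by (simp only: t'_def)
qed

end
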